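(* For $b\in(3.06,3.062)$, $$\min_{z\in\mathbb{H}}\big(\zeta(6,z)-b\zeta(3,z)\big)=\min_{z\in\overline{\mathcal{D}_{\mathcal{G}}}}\big(\zeta(6,z)-b\zeta(3,z)\big)$$ and this minimum is achieved at $z=i$.
   Context: $\mathbb{H}=\{z: \Im z>0\}$. For $s>1$, $\zeta(s,z)=\sum_{(m,n)\in\mathbb{Z}^2\setminus\{0\}}\frac{(\Im z)^s}{|mz+n|^{2s}}$. $\mathcal{D}_{\mathcal{G}}=\{z\in\mathbb{H}: |z|>1,\ 0<\Re z<\frac12\}$. *)

theory Defs
  imports "HOL-Analysis.Analysis"
begin

definition upper_half_plane :: "complex set" where
  "upper_half_plane = {z. Im z > 0}"

text \<open>Epstein zeta function of the lattice: for s > 1 and z in the upper half plane,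
  zeta(s,z) = sum over (m,n) in Z^2 minus 0 of (Im z)^s / |m z + n|^(2s).
  The terms are nonnegative, so the unordered infinite sum is the natural rendering.\<close>
definition lattice_zeta :: "real \<Rightarrow> complex \<Rightarrow> real" where
  "lattice_zeta s z =
     infsum (\<lambda>(m::int, n::int).
        (Im z) powr s / (cmod (of_int m * z + of_int n)) powr (2 * s))
       (UNIV - {(0,0)})"

definition D_G :: "complex set" where
  "D_G = {z. Im z > 0 \<and> cmod z > 1 \<and> 0 < Re z \<and> Re z < 1/2}"

end

theory Submission
  imports Defs
begin

text \<open>The numbers \<open>|m z + n|\<^sup>2 / Im z\<close> are the values of a positive definite binary
  quadratic form \<open>q(m,n) = p (m\<^sup>2 + n\<^sup>2) + u (m\<^sup>2 - n\<^sup>2) + 2 h m n\<close> with \<open>p\<^sup>2 = 1 + u\<^sup>2 + h\<^sup>2\<close>, and \<open>z = \<i>\<close>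
  gives \<open>m\<^sup>2 + n\<^sup>2\<close>. Averaging over the symmetries of the square lattice makes the difference to the value
  at \<open>\<i>\<close> a sum of terms which are even in \<open>u\<close> and \<open>h\<close>, hence of second order at \<open>\<i>\<close>, so that the tail of the
  sum can be estimated by a small multiple of \<open>4 p\<^sup>3 - 3 p - 1\<close>, which has a simple zero at \<open>p = 1\<close>.
  For a reduced form, \<open>0 \<le> u\<close> and \<open>0 \<le> 2 h \<le> p - u\<close>, the explicit terms are bounded from below at constant
  \<open>h\<close>: on the unit circle \<open>u = 0\<close> the bound is a polynomial inequality in \<open>p\<close>, and leaving the circle the
  vectors \<open>(1,0)\<close>, \<open>(0,1)\<close> (for small \<open>h\<close>) or \<open>(1,-1)\<close> (for larger \<open>h\<close>) compensate all losses.\<close>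

section \<open>Sums over the square lattice\<close>

text \<open>In the half-plane, p is the hyperbolic cosine of the distance from i to z, u = 0 is the
  unit circle, and h = Re z / Im z is constant on rays from 0; a reduced form belongs to |z| >= 1, 0
  <= Re z <= 1/2. The obstacle is that the minimum at i is shallow along the circle. Measure slopes
  in p at p = 1, in the normalisation of \<open>lower\<close>: the vectors (1,0), (0,1) gain 6
  \<beta> - 12, about 6.7, while (1,1), (1,-1) lose 9 \<beta> / 4 - 9/8, about 5.9. Only about 0.8
  remains, and bounding (2,1) and its double by the crude multiple of 4 p^3 - 3 p - 1 would already
  cost about 0.9. So (2,1), (4,2), (3,1), (3,2) keep Taylor expansions in u and h, which make up
  \<open>rest_bound\<close>; the crude bound serves for the other vectors and for the remaining
  inverse sixth powers. The second tight place is the hexagonal lattice, h = 1 / sqrt 3, at the far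
  end of the arc. Off the circle, (1,0) and (0,1) gain to first order in u^2 only while \<beta>
  times the cube of \<open>p\<^sub>0\<close> is below 4; for larger h the vector (1,-1) must
  outweigh their loss.\<close>

definition grid_box :: "nat \<Rightarrow> (int \<times> int) set" where
  "grid_box M = {- int M..int M} \<times> {- int M..int M}"

lemma finite_grid_box [simp]: "finite (grid_box M)"
  by (simp add: grid_box_def)

lemma grid_box_mono: "M \<le> M' \<Longrightarrow> grid_box M \<subseteq> grid_box M'"
  by (auto simp: grid_box_def)

lemma finite_subset_grid_box:
  assumes "finite F"
  obtains M where "F \<subseteq> grid_box M" "k \<le> M"
proof -
  define M where "M = k + Max (insert 0 ((\<lambda>(m, n). nat (\<bar>m\<bar> + \<bar>n\<bar>)) ` F))"
  have "F \<subseteq> grid_box M"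
  proof
    fix v assume "v \<in> F"
    then have "(\<lambda>(m, n). nat (\<bar>m\<bar> + \<bar>n\<bar>)) v \<le> Max (insert 0 ((\<lambda>(m, n). nat (\<bar>m\<bar> + \<bar>n\<bar>)) ` F))"
      using assms by (intro Max_ge) auto
    then have "(\<lambda>(m, n). nat (\<bar>m\<bar> + \<bar>n\<bar>)) v \<le> M" unfolding M_def by linarith
    then show "v \<in> grid_box M" by (cases v) (auto simp: grid_box_def)
  qed
  with that[of M] show thesis by (simp add: M_def)
qed

section \<open>Dihedrally symmetric sums over squares\<close>

locale dihedral =
  fixes G :: "int \<times> int \<Rightarrow> real"
  assumes swap: "G (n, m) = G (m, n)" and flip: "G (- m, n) = G (m, n)"
begin

lemma flip': "G (m, - n) = G (m, n)"
  by (metis swap flip)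

lemma sum_line: "(\<Sum>n=- int M..int M. G (m, n)) = G (m, 0) + 2 * (\<Sum>n=1..M. G (m, int n))"
proof (induction M)
  case (Suc M)
  have "{- int (Suc M)..int (Suc M)} = insert (int (Suc M)) (insert (- int (Suc M)) {- int M..int M})"
    by auto
  then have "(\<Sum>n=- int (Suc M)..int (Suc M). G (m, n))
      = G (m, int (Suc M)) + (G (m, - int (Suc M)) + (\<Sum>n=- int M..int M. G (m, n)))"
    by simp
  then show ?case using Suc by (simp only: flip') (simp add: algebra_simps)
qed simp

text \<open>The vectors of maximum norm \<open>Suc M\<close> split into orbits of the symmetry group
  of the square: four on the axes, four corners, and eight for each \<open>n\<close> strictly in
  between.\<close>

lemma sum_box_Suc:
  "sum G (grid_box (Suc M)) = sum G (grid_box M) + 4 * G (int (Suc M), 0)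
     + 8 * (\<Sum>n=1..M. G (int (Suc M), int n)) + 4 * G (int (Suc M), int (Suc M))"
proof -
  let ?k = "int (Suc M)"
  have I: "{- ?k..?k} = insert ?k (insert (- ?k) {- int M..int M})"
    by auto
  have *: "(\<Sum>n=- ?k..?k. G (m, n)) = (\<Sum>n=- int M..int M. G (m, n)) + 2 * G (m, ?k)" for m
    by (simp only: sum_line) (simp add: algebra_simps)
  have "sum G (grid_box (Suc M)) = (\<Sum>m=- ?k..?k. \<Sum>n=- ?k..?k. G (m, n))"
    by (simp add: grid_box_def sum.cartesian_product case_prod_unfold)
  also have "\<dots> = (\<Sum>n=- ?k..?k. G (?k, n)) + ((\<Sum>n=- ?k..?k. G (- ?k, n))
      + (\<Sum>m=- int M..int M. \<Sum>n=- ?k..?k. G (m, n)))"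
    by (subst (1) I) simp
  also have "(\<Sum>m=- int M..int M. \<Sum>n=- ?k..?k. G (m, n))
      = sum G (grid_box M) + 2 * (\<Sum>m=- int M..int M. G (?k, m))"
    by (simp only: * sum.distrib sum_distrib_left[symmetric] swap[of _ ?k])
       (simp add: grid_box_def sum.cartesian_product case_prod_unfold)
  finally show ?thesis by (simp only: flip sum_line) (simp add: algebra_simps)
qed

end

section \<open>The tail of the sum of inverse cubes\<close>

definition inv_cube :: "int \<times> int \<Rightarrow> real" where
  "inv_cube = (\<lambda>(m, n). 1 / (real_of_int m ^ 2 + real_of_int n ^ 2) ^ 3)"

lemma inv_cube_nonneg: "0 \<le> inv_cube v"
  by (cases v) (simp add: inv_cube_def)

interpretation inv_cube: dihedral inv_cube
  by unfold_locales (simp_all add: inv_cube_def add.commute)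

text \<open>The ring has 8 (M + 1) points, and each has squared length at least (M + 1)^2.\<close>

lemma inv_cube_ring_le:
  "sum inv_cube (grid_box (Suc M)) \<le> sum inv_cube (grid_box M) + 8 / real (Suc M) ^ 5"
proof -
  let ?k = "real (Suc M)"
  define c where "c = 1 / ?k ^ 6"
  have le: "inv_cube (int (Suc M), n) \<le> c" for n
  proof -
    have "?k ^ 6 = (?k\<^sup>2) ^ 3" by (simp flip: power_mult)
    also have "\<dots> \<le> (?k\<^sup>2 + (real_of_int n)\<^sup>2) ^ 3" by (intro power_mono) auto
    finally show ?thesis unfolding inv_cube_def c_def by (simp add: frac_le)
  qed
  have "(\<Sum>n=1..M. inv_cube (int (Suc M), int n)) \<le> (\<Sum>n=1..M. c)"
    by (intro sum_mono le)
  then have "4 * inv_cube (int (Suc M), 0) + 8 * (\<Sum>n=1..M. inv_cube (int (Suc M), int n))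
      + 4 * inv_cube (int (Suc M), int (Suc M)) \<le> 8 * (?k * c)"
    using le[of 0] le[of "int (Suc M)"] by (simp add: algebra_simps)
  also have "?k * c = 1 / ?k ^ 5" by (simp add: c_def eval_nat_numeral)
  finally show ?thesis unfolding inv_cube.sum_box_Suc by simp
qed

text \<open>The ring bounds telescope: by comparison with an integral, 8 / (x + 1)^5 is at most 2 (1
  / x^4 - 1 / (x + 1)^4).\<close>

lemma sum_inv_cube_box_le:
  assumes "8 \<le> M"
  shows "sum inv_cube (grid_box M) \<le> sum inv_cube (grid_box 8) + 2 * (1 / 8 ^ 4 - 1 / real M ^ 4)"
  using assms
proof (induction M rule: dec_induct)
  case (step M)
  define x where "x = real M"
  have x: "8 \<le> x" using step by (simp add: x_def)
  have "4 / (x + 1) ^ 5 \<le> 1 / x ^ 4 - 1 / (x + 1) ^ 4"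
  proof -
    have "x ^ 4 * (x + 5) \<le> (x + 1) ^ 5"
      using x by (simp add: eval_nat_numeral algebra_simps)
    then show ?thesis using x by (simp add: divide_simps) (simp add: eval_nat_numeral algebra_simps)
  qed
  then show ?case using step inv_cube_ring_le[of M] by (simp add: x_def add.commute)
qed simp

lemma sum_inv_cube_box8: "sum inv_cube (grid_box 8) \<le> sum inv_cube (grid_box 4) + (47/20000)"
proof -
  have "sum inv_cube (grid_box 8) = sum inv_cube (grid_box (Suc (Suc (Suc (Suc 4)))))" by simp
  then show ?thesis unfolding inv_cube.sum_box_Suc 
    by (simp add: inv_cube_def numeral_eq_Suc atLeastAtMostSuc_conv)
qed

text \<open>Rings 5 to 8 are summed term by term, since the ring bound from 5 on would give 2 / 4^4,
  almost three times the present constant. The constant is 47/20000 + 2 / 8^4, rounded up.\<close>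

lemma sum_inv_cube_outside:
  assumes "finite F" "F \<inter> grid_box 4 = {}"
  shows "sum inv_cube F \<le> (71/25000)"
proof -
  obtain M where M: "F \<subseteq> grid_box M" "8 \<le> M" using finite_subset_grid_box[OF assms(1)] by blast
  have "sum inv_cube F + sum inv_cube (grid_box 4) = sum inv_cube (F \<union> grid_box 4)"
    using assms by (simp add: sum.union_disjoint)
  also have "\<dots> \<le> sum inv_cube (grid_box M)"
    using M grid_box_mono[of 4 M] inv_cube_nonneg by (intro sum_mono2) auto
  also have "\<dots> \<le> sum inv_cube (grid_box 8) + 2 * (1 / 8 ^ 4 - 1 / real M ^ 4)"
    using M by (intro sum_inv_cube_box_le)
  also have "\<dots> \<le> sum inv_cube (grid_box 8) + 2 * (1 / 8 ^ 4)" by simp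
  finally show ?thesis using sum_inv_cube_box8 by simp
qed

lemma inv_cube_summable_outside: "inv_cube summable_on (- grid_box 4)"
proof (rule nonneg_bdd_above_summable_on)
  show "bdd_above (sum inv_cube ` {F. F \<subseteq> - grid_box 4 \<and> finite F})"
    by (rule bdd_aboveI2[where M = "(71/25000)"], rule sum_inv_cube_outside) auto
qed (rule inv_cube_nonneg)

lemma infsum_inv_cube_outside: "infsum inv_cube (- grid_box 4) \<le> (71/25000)"
  by (intro infsum_le_finite_sums inv_cube_summable_outside sum_inv_cube_outside) auto

lemma inv_cube_summable: "inv_cube summable_on UNIV"
  using summable_on_Un_disjoint[OF summable_on_finite[OF finite_grid_box] inv_cube_summable_outside]
  by (metis Compl_partition Compl_disjoint)

section \<open>The inequality for a reduced form\<close>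

text \<open>With \<open>j = 1/p\<close>, \<open>U = u\<^sup>2\<close>, \<open>H = h\<^sup>2\<close>, this bounds what the lattice vectors equivalent to
  \<open>(2,1)\<close>, \<open>(4,2)\<close>, \<open>(3,1)\<close> and \<open>(3,2)\<close> contribute to (half of) the difference of the cubic sums;
  the coefficients are rounded in the unfavourable direction.\<close>

definition rest_bound :: "real \<Rightarrow> real \<Rightarrow> real \<Rightarrow> real" where
  "rest_bound j U H =
     (479/12500) * (j ^ 3 - 1)
     + 24 * j ^ 5 * ((3633/1000000) * U + (1487/250000) * H)
     + 60 * j ^ 7 * ((1053/1000000) * U\<^sup>2 + (351/31250) * (U * H) + (52/15625) * H\<^sup>2)
     + (16 * j ^ 3 + 36 * j ^ 5 + 60 * j ^ 7)
       * ((9477/25000000) * U ^ 3 + (3159/312500) * (U\<^sup>2 * H) + (1404/78125) * (U * H\<^sup>2) + (832/390625) * H ^ 3)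
     + (16 * j + 20 * j ^ 3 + 24 * j ^ 5)
       * ((21/50000) * U\<^sup>2 + (173/100000) * (U * H) + (461/1000000) * H\<^sup>2)"

section \<open>The bound on the unit circle as a polynomial inequality\<close>

lemma power_Suc_le_mult:
  fixes d D :: real
  assumes "0 \<le> d" "d \<le> D"
  shows "d ^ Suc k \<le> D * d ^ k"
  using mult_right_mono[OF assms(2), of "d ^ k"] assms(1) by simp

text \<open>Up to rounding, the interval ends at the hexagonal lattice, and there the quintic has
  its minimum, about 0.016. Far from that end the linear term absorbs the negative ones; near it,
  the polynomial is expanded at the end point.\<close>

lemma quintic_pos:
  fixes d :: real
  assumes "0 \<le> d" "d \<le> (387/2500)"
  shows "(14161/100000) + (7951/2500) * d - (83/4) * d\<^sup>2 - (5671/100) * d ^ 3 + (809/10) * d ^ 4 + (4849/10) * d ^ 5 > 0"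
proof (cases "d \<le> (1/10)")
  case True
  have le: "d ^ Suc k \<le> (1/10) * d ^ k" for k using assms True by (intro power_Suc_le_mult) auto
  have "d\<^sup>2 \<le> (1/10) * d" "d ^ 3 \<le> (1/10) * d\<^sup>2" using le[of 1] le[of 2] by (simp_all add: eval_nat_numeral)
  moreover have "d ^ 4 \<ge> 0" "d ^ 5 \<ge> 0" using assms by auto
  ultimately show ?thesis using assms by linarith
next
  case False
  define e where "e = (387/2500) - d"
  have e: "0 \<le> e" "e \<le> (137/2500)" using assms False by (auto simp: e_def)
  have d: "d = (387/2500) - e" by (simp add: e_def)
  have le: "e ^ Suc k \<le> (137/2500) * e ^ k" for k using e by (intro power_Suc_le_mult) auto
  have le: "e ^ 2 \<le> (137/2500) * e" "e ^ 5 \<le> (137/2500) * e ^ 4" "e ^ 4 \<le> (137/2500) * e ^ 3" "e ^ 3 \<le> (137/2500) * e ^ 2"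
    using le[of 1] le[of 4] le[of 3] le[of 2] by (simp_all add: eval_nat_numeral)
  have "(14161/100000) + (7951/2500) * d - (83/4) * d\<^sup>2 - (5671/100) * d ^ 3 + (809/10) * d ^ 4 + (4849/10) * d ^ 5
    = (15523675421375743/976562500000000000) + (369377395923511/78125000000000) * e ^ 1
        + (-272925042053/15625000000) * e ^ 2 + (-684875381/6250000) * e ^ 3
        + (2281063/5000) * e ^ 4 + (-4849/10) * e ^ 5"
        unfolding d by algebra
  moreover have "e ^ 2 \<ge> 0" "e ^ 3 \<ge> 0" "e ^ 4 \<ge> 0" "e ^ 5 \<ge> 0" using e by auto
  ultimately show ?thesis using e le unfolding power_0 power_one_right by linarith
qed

text \<open>The factor of - \<beta> is nonpositive, so the smallest \<beta> is the worst.
  Multiplying by \<open>p ^ 7\<close> leaves a polynomial in \<open>d = p - 1\<close> without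
  constant term; its quotient by \<open>d\<close>, truncated and rounded down, is the quintic above.
  The left-hand side is a reserve that \<open>lower_nonneg_region\<close> spends.\<close>

lemma arc_bound:
  fixes p \<beta> :: real
  assumes p: "1 \<le> p" "p \<le> (2887/2500)" and \<beta>: "(31127/10000) \<le> \<beta>"
  shows "(3/100) * (p\<^sup>2 - 1) \<le> 2 / p ^ 6 - 2 + ((p * (4 * p\<^sup>2 - 3))\<^sup>2 - 1) / 16
           - \<beta> * (2 / p ^ 3 - 2 + (4 * p ^ 3 - 3 * p - 1) / 4)
           - (1531/500) * rest_bound (1 / p) 0 (p\<^sup>2 - 1) - (41/5000) * (4 * p ^ 3 - 3 * p - 1)"
proof -
  define d where "d = p - 1"
  have d: "0 \<le> d" "d \<le> (387/2500)" and pd: "p = 1 + d" using p by (auto simp: d_def)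
  have J: "2 / p ^ 3 - 2 + (4 * p ^ 3 - 3 * p - 1) / 4 \<le> 0"
  proof -
    have le: "d ^ Suc k \<le> (387/2500) * d ^ k" for k using d by (intro power_Suc_le_mult) auto
    have "d ^ 2 \<le> (387/2500) * d" "d ^ 3 \<le> (387/2500) * d^2" "d ^ 4 \<le> (387/2500) * d^3" "d ^ 5 \<le> (387/2500) * d^4" "d ^ 6 \<le> (387/2500) * d^5"
      using le[of 1] le[of 2] le[of 3] le[of 4] le[of 5] by (simp_all add: eval_nat_numeral)
    then have "8 - 8 * p ^ 3 + p ^ 3 * (4 * p ^ 3 - 3 * p - 1) \<le> 0"
      using d unfolding pd by (simp add: eval_nat_numeral algebra_simps)
    moreover have "2 / p ^ 3 - 2 + (4 * p ^ 3 - 3 * p - 1) / 4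
        = (8 - 8 * p ^ 3 + p ^ 3 * (4 * p ^ 3 - 3 * p - 1)) / (4 * p ^ 3)"
      using p by (simp add: field_simps)
    ultimately show ?thesis using p by (simp add: divide_nonpos_nonneg)
  qed
  have "(31127/10000) * (2 / p ^ 3 - 2 + (4 * p ^ 3 - 3 * p - 1) / 4)
         \<ge> \<beta> * (2 / p ^ 3 - 2 + (4 * p ^ 3 - 3 * p - 1) / 4)"
    using \<beta> J by (intro mult_right_mono_neg) auto
  moreover have "0 \<le> 2 / p ^ 6 - 2 + ((p * (4 * p\<^sup>2 - 3))\<^sup>2 - 1) / 16
           - (31127/10000) * (2 / p ^ 3 - 2 + (4 * p ^ 3 - 3 * p - 1) / 4)
           - (1531/500) * rest_bound (1 / p) 0 (p\<^sup>2 - 1) - (41/5000) * (4 * p ^ 3 - 3 * p - 1) - (3/100) * (p\<^sup>2 - 1)" (is "0 \<le> ?E")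
  proof -
    define Q where "Q = (14161/100000) + (7951/2500) * d - (83/4) * d\<^sup>2 - (5671/100) * d ^ 3 + (809/10) * d ^ 4 + (4849/10) * d ^ 5"
    have "?E * p ^ 7 = 2 * p - 2 * p^7 + p^7 * ((p * (4 * p\<^sup>2 - 3))\<^sup>2 - 1) / 16
           - (31127/10000) * (2 * p^4 - 2*p^7 + p^7 * (4 * p ^ 3 - 3 * p - 1) / 4)
           - (1531/500) * ((479/12500) * (p^4 - p^7) + 24 * p^2 * ((1487/250000) * (p\<^sup>2 - 1))
              + 60 * ((52/15625) * (p\<^sup>2 - 1)\<^sup>2) + (16 * p ^ 4 + 36 * p ^ 2 + 60) * ((832/390625) * (p\<^sup>2 - 1) ^ 3)
              + (16 * p^6 + 20 * p ^ 4 + 24 * p ^ 2) * ((461/1000000) * (p\<^sup>2 - 1)\<^sup>2))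
           - (41/5000) * (4 * p ^ 3 - 3 * p - 1) * p^7 - (3/100) * (p\<^sup>2 - 1) * p^7"
    proof -
      have [simp]: "p \<noteq> 0" using p by auto
      have i: "p ^ 7 / p = p^6" "p ^ 7 / p ^ 3 = p ^ 4" "p ^ 7 / p ^ 5 = p ^ 2" "p ^ 7 / p ^ 6 = p" "p^7 / p ^ 7 = 1"
        by (simp_all add: divide_simps eval_nat_numeral)
      have "?E * p ^ 7 = 2 * (p ^ 7 / p ^ 6) - 2 * p^7 + p^7 * ((p * (4 * p\<^sup>2 - 3))\<^sup>2 - 1) / 16
           - (31127/10000) * (2 * (p ^ 7 / p ^ 3) - 2*p^7 + p^7 * (4 * p ^ 3 - 3 * p - 1) / 4)
           - (1531/500) * ((479/12500) * (p^7/p^3 - p^7) + 24 * (p^7/p^5) * ((1487/250000) * (p\<^sup>2 - 1))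
              + 60 * (p^7/p^7) * ((52/15625) * (p\<^sup>2 - 1)\<^sup>2) + (16 * (p ^ 7/p^3) + 36 * (p^7/p^5) + 60 * (p^7/p^7)) * ((832/390625) * (p\<^sup>2 - 1) ^ 3)
              + (16 * (p^7/p) + 20 * (p ^ 7/p^3) + 24 * (p ^ 7/p^5)) * ((461/1000000) * (p\<^sup>2 - 1)\<^sup>2))
           - (41/5000) * (4 * p ^ 3 - 3 * p - 1) * p^7 - (3/100) * (p\<^sup>2 - 1) * p^7"
        unfolding rest_bound_def by (simp add: power_one_over algebra_simps add_divide_distrib diff_divide_distrib)
      then show ?thesis unfolding i by simp
    qed
    also have "\<dots> = (17702409/125000000) * d ^ 1 + (79510479/25000000) * d ^ 2
        + (-64843045387/3125000000) * d ^ 3 + (-88609140227/1562500000) * d ^ 4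
        + (50570383491/625000000) * d ^ 5 + (1515363072597/3125000000) * d ^ 6
        + (2725653420747/3125000000) * d ^ 7 + (1405448874837/1562500000) * d ^ 8
        + (93798149449/156250000) * d ^ 9 + (103995142831/390625000) * d ^ 10 + (153/2) * d ^ 11
        + 13 * d ^ 12 + d ^ 13"
      (is "_ = ?C")
      unfolding pd by algebra
    finally have eq: "?E * p ^ 7 = ?C" .
    have "?C \<ge> d * Q"
    proof -
      have "d * Q = (14161/100000) * d + (7951/2500) * d ^ 2 - (83/4) * d ^ 3 - (5671/100) * d ^ 4 + (809/10) * d ^ 5 + (4849/10) * d ^ 6"
        unfolding Q_def by algebra
      moreover have nn: "d ^ k \<ge> 0" for k using d by auto
      moreover note nn[of 7] nn[of 8] nn[of 9] nn[of 10] nn[of 11] nn[of 12] nn[of 13] nn[of 6]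
        nn[of 2] nn[of 3] nn[of 4] nn[of 5] d
      ultimately show ?thesis unfolding power_one_right by linarith
    qed
    moreover have "d * Q \<ge> 0" using quintic_pos[OF d] d unfolding Q_def by (intro mult_nonneg_nonneg) auto
    ultimately have "0 \<le> ?E * p ^ 7" unfolding eq by linarith
    moreover have "0 < p ^ 7" using p by simp
    ultimately show ?thesis by (simp only: zero_le_mult_iff) linarith
  qed
  ultimately show ?thesis by linarith
qed

text \<open>The divided difference of \<open>rest_bound\<close> in \<open>U\<close>, taken between 0
  and \<open>U\<close>.\<close>

definition rest_slope :: "real \<Rightarrow> real \<Rightarrow> real \<Rightarrow> real" where
  "rest_slope j U H =
     24 * (3633/1000000) * j ^ 5
     + 60 * j ^ 7 * ((1053/1000000) * U + (351/31250) * H)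
     + (16 * j ^ 3 + 36 * j ^ 5 + 60 * j ^ 7)
       * ((9477/25000000) * U\<^sup>2 + (3159/312500) * (U * H) + (1404/78125) * H\<^sup>2)
     + (16 * j + 20 * j ^ 3 + 24 * j ^ 5) * ((21/50000) * U + (173/100000) * H)"

lemma rest_slope_mono:
  assumes "0 \<le> j" "j \<le> j'" "0 \<le> U" "U \<le> U'" "0 \<le> H" "H \<le> H'"
  shows "rest_slope j U H \<le> rest_slope j' U' H'"
  unfolding rest_slope_def using assms
  by (intro add_mono mult_mono power_mono order_refl) auto

lemma rest_bound_diff:
  assumes "0 \<le> j" "j \<le> i" "0 \<le> U" "0 \<le> H"
  shows "rest_bound j U H - rest_bound i 0 H \<le> U * rest_slope i U H"
proof -
  have "rest_bound j U H \<le> rest_bound i U H"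
    unfolding rest_bound_def using assms
    by (intro add_mono mult_mono power_mono mult_left_mono diff_mono) auto
  also have "\<dots> = rest_bound i 0 H + U * rest_slope i U H"
    unfolding rest_bound_def rest_slope_def power_zero_numeral mult_zero_left mult_zero_right add_0_left
    by algebra
  finally show ?thesis by simp
qed

text \<open>Needed in order to replace the factor \<open>b\<close> of \<open>rest_bound\<close> by
  its upper bound. The only negative term is \<open>j ^ 3 - 1\<close>; lowering the other
  coefficients to those of powers of \<open>V = U + H\<close> reduces the claim to a polynomial in
  \<open>p\<close> alone.\<close>

lemma rest_bound_nonneg:
  assumes "1 \<le> p" "0 \<le> U" "0 \<le> H" "p\<^sup>2 = 1 + U + H"
  shows "0 \<le> rest_bound (1 / p) U H"
proof -
  define j V where "j = 1 / p" and "V = U + H"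
  have j: "0 < j" "j \<le> 1" and jp: "j * p = 1" using assms by (auto simp: j_def)
  have V: "0 \<le> V" "V = p\<^sup>2 - 1" using assms by (auto simp: V_def)
  have UH: "0 \<le> U\<^sup>2" "0 \<le> H\<^sup>2" "0 \<le> U * H" "0 \<le> U\<^sup>2 * H" "0 \<le> U * H\<^sup>2" "0 \<le> H ^ 3" "0 \<le> U ^ 3"
    using assms by auto
  have V2: "V\<^sup>2 = U\<^sup>2 + 2 * (U * H) + H\<^sup>2" "V ^ 3 = U ^ 3 + 3 * (U\<^sup>2 * H) + 3 * (U * H\<^sup>2) + H ^ 3"
    unfolding V_def by algebra+
  define d where "d = p - 1"
  have d: "0 \<le> d" "p = 1 + d" using assms by (auto simp: d_def)
  define Q where "Q = - (1437/25000) * p ^ 5 + 24 * (3633/1000000) * p\<^sup>2 + 60 * (1053/1000000) * V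
      + (16 * p ^ 4 + 36 * p\<^sup>2 + 60) * ((9477/25000000) * V\<^sup>2) + (16 * p ^ 6 + 20 * p ^ 4 + 24 * p\<^sup>2) * ((21/50000) * V)"
  have "0 \<le> Q"
  proof -
    have nn: "0 \<le> d ^ k" for k using d by simp
    have "Q = (1857/62500) + (996/15625) * d ^ 1 + (-257751/6250000) * d ^ 2
        + (340449/1562500) * d ^ 3 + (2058471/3125000) * d ^ 4 + (211773/312500) * d ^ 5
        + (2257401/6250000) * d ^ 6 + (39954/390625) * d ^ 7 + (19977/1562500) * d ^ 8"
        unfolding Q_def V(2) d(2) by algebra
    moreover have "0 \<le> d * (d - 1)\<^sup>2" using d by simp
    then have "2 * d ^ 2 \<le> d + d ^ 3" by (simp add: power2_eq_square power3_eq_cube algebra_simps)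
    ultimately show ?thesis
      using nn[of 3] nn[of 4] nn[of 5] nn[of 6] nn[of 7] nn[of 8] d unfolding power_0 power_one_right by linarith
  qed
  have "0 \<le> j ^ 7 * V * Q" using j V \<open>0 \<le> Q\<close> by simp
  also have "j ^ 7 * V * Q = - (1437/25000) * (j\<^sup>2 * V) + 24 * j ^ 5 * ((3633/1000000) * V) + 60 * j ^ 7 * ((1053/1000000) * V\<^sup>2)
      + (16 * j ^ 3 + 36 * j ^ 5 + 60 * j ^ 7) * ((9477/25000000) * V ^ 3) + (16 * j + 20 * j ^ 3 + 24 * j ^ 5) * ((21/50000) * V\<^sup>2)"
    unfolding Q_def using jp by algebra
  also have "\<dots> \<le> rest_bound j U H"
  proof -
    \<comment> \<open>The convex function s^(3/2) lies above its tangent at s = 1, used for s = j^2.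
      Since j^2 V = 1 - j^2, this makes the factor V appear.\<close>
    have "j ^ 3 - 1 \<ge> - (3/2) * (j\<^sup>2 * V)"
    proof -
      have eq: "j\<^sup>2 * V = 1 - j\<^sup>2" unfolding V(2) using jp by algebra
      have "0 \<le> (1 - j)\<^sup>2 * (j + 1 / 2)" using j by simp
      also have "\<dots> = j ^ 3 - 1 + (3/2) * (1 - j\<^sup>2)" by algebra
      finally show ?thesis unfolding eq by linarith
    qed
    from mult_left_mono[OF this, of "479/12500"]
    have "- (1437/25000) * (j\<^sup>2 * V) \<le> (479/12500) * (j ^ 3 - 1)" by simp
    moreover have "(3633/1000000) * V \<le> (3633/1000000) * U + (1487/250000) * H"
      "(1053/1000000) * V\<^sup>2 \<le> (1053/1000000) * U\<^sup>2 + (351/31250) * (U * H) + (52/15625) * H\<^sup>2"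
      "(9477/25000000) * V ^ 3 \<le> (9477/25000000) * U ^ 3 + (3159/312500) * (U\<^sup>2 * H) + (1404/78125) * (U * H\<^sup>2) + (832/390625) * H ^ 3"
      "(21/50000) * V\<^sup>2 \<le> (21/50000) * U\<^sup>2 + (173/100000) * (U * H) + (461/1000000) * H\<^sup>2"
      using UH assms(3) unfolding V2 by (simp_all add: V_def field_simps)
    ultimately show ?thesis
      unfolding rest_bound_def using j by (intro add_mono mult_left_mono) auto
  qed
  finally show ?thesis unfolding j_def .
qed

text \<open>The derivative of the cubic with respect to p^2 is (12 p^2 - 3) / (2 p), which is below
  6 p.\<close>

lemma cubic_diff:
  fixes p p\<^sub>0 U :: real
  assumes "0 < p\<^sub>0" "p\<^sub>0 \<le> p" "p\<^sup>2 = p\<^sub>0\<^sup>2 + U"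
  shows "(4 * p ^ 3 - 3 * p - 1) - (4 * p\<^sub>0 ^ 3 - 3 * p\<^sub>0 - 1) \<le> 6 * p * U"
proof -
  have "6 * p * U - ((4 * p ^ 3 - 3 * p - 1) - (4 * p\<^sub>0 ^ 3 - 3 * p\<^sub>0 - 1))
     = (p - p\<^sub>0) * (2 * (p - p\<^sub>0) * (p + 2 * p\<^sub>0) + 3)"
  proof -
    have U: "U = p\<^sup>2 - p\<^sub>0\<^sup>2" using assms by simp
    show ?thesis unfolding U by algebra
  qed
  also have "\<dots> \<ge> 0" using assms by (intro mult_nonneg_nonneg add_nonneg_nonneg) auto
  finally show ?thesis by simp
qed

section \<open>The shortest vectors: exact formulas and increments\<close>

lemma inverse_powers_sum:
  fixes a c :: real
  assumes "a \<noteq> 0" "c \<noteq> 0"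
  shows "1 / a ^ 3 + 1 / c ^ 3 = (a ^ 3 + c ^ 3) / (a * c) ^ 3"
    and "1 / a ^ 6 + 1 / c ^ 6 = ((a ^ 3 + c ^ 3)\<^sup>2 - 2 * (a * c) ^ 3) / (a * c) ^ 6"
proof -
  show "1 / a ^ 3 + 1 / c ^ 3 = (a ^ 3 + c ^ 3) / (a * c) ^ 3"
    using assms by (simp add: field_simps)
  have "(a ^ 3 + c ^ 3)\<^sup>2 - 2 * (a * c) ^ 3 = a ^ 6 + c ^ 6" by algebra
  then show "1 / a ^ 6 + 1 / c ^ 6 = ((a ^ 3 + c ^ 3)\<^sup>2 - 2 * (a * c) ^ 3) / (a * c) ^ 6"
    using assms by (simp add: field_simps)
qed

text \<open>The product of \<open>p + u\<close> and \<open>p - u\<close> is fixed by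
  \<open>p\<^sub>0\<close>, so all depends on the sum of their cubes. \<open>X\<close> is the excess
  of that sum over its value on the circle, and the result is quadratic in \<open>X\<close>.\<close>

lemma axis_terms:
  fixes p u p\<^sub>0 \<beta> :: real
  assumes "0 < p\<^sub>0" "p\<^sup>2 = p\<^sub>0\<^sup>2 + u\<^sup>2"
  defines "X \<equiv> 2 * (p - p\<^sub>0) * (2 * p + p\<^sub>0)\<^sup>2"
  shows "1 / (p + u) ^ 6 + 1 / (p - u) ^ 6 - \<beta> * (1 / (p + u) ^ 3 + 1 / (p - u) ^ 3)
       = 2 / p\<^sub>0 ^ 6 - 2 * \<beta> / p\<^sub>0 ^ 3 + X * (X + 4 * p\<^sub>0 ^ 3 - \<beta> * p\<^sub>0 ^ 6) / p\<^sub>0 ^ 12"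
proof -
  have prod: "(p + u) * (p - u) = p\<^sub>0\<^sup>2" using assms(2) by algebra
  then have nz: "p + u \<noteq> 0" "p - u \<noteq> 0" using assms(1) by auto
  have S: "(p + u) ^ 3 + (p - u) ^ 3 = X + 2 * p\<^sub>0 ^ 3" using assms(2) unfolding X_def by algebra
  have pw: "(p\<^sub>0\<^sup>2) ^ 3 = p\<^sub>0 ^ 6" "(p\<^sub>0\<^sup>2) ^ 6 = p\<^sub>0 ^ 12" by (simp_all flip: power_mult)
  define y where "y = p\<^sub>0 ^ 3"
  have "y \<noteq> 0" using assms(1) by (simp add: y_def)
  have y: "p\<^sub>0 ^ 6 = y\<^sup>2" "p\<^sub>0 ^ 12 = y ^ 4" by (simp_all add: y_def flip: power_mult)
  show ?thesis
    unfolding inverse_powers_sum[OF nz] prod S pw y y_def[symmetric] using \<open>y \<noteq> 0\<close>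
    by (simp add: field_simps) algebra
qed

text \<open>In x = t^-3 the function is the parabola x^2 - \<beta> x, which decreases as long as 2 x
  <= \<beta>. By convexity of t^-3 its decrease has slope at least \<open>3 / T ^ 4\<close>;
  \<open>x\<^sub>0\<close> leaves room for rounding.\<close>

lemma lj_increment:
  fixes t t\<^sub>0 x\<^sub>0 T \<beta> :: real
  assumes "0 < t\<^sub>0" "t\<^sub>0 \<le> t" "t \<le> T" "1 / t\<^sub>0 ^ 3 \<le> x\<^sub>0" "2 * x\<^sub>0 \<le> \<beta>"
  shows "(\<beta> - 2 * x\<^sub>0) * (3 / T ^ 4) * (t - t\<^sub>0) \<le> (1 / t ^ 6 - \<beta> / t ^ 3) - (1 / t\<^sub>0 ^ 6 - \<beta> / t\<^sub>0 ^ 3)"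
proof -
  define x y where "x = 1 / t ^ 3" and "y = 1 / t\<^sub>0 ^ 3"
  have t: "0 < t" "0 < T" using assms by auto
  have xy: "x \<le> y" unfolding x_def y_def using assms t by (intro divide_left_mono power_mono) auto
  have sq: "1 / t ^ 6 = x\<^sup>2" "1 / t\<^sub>0 ^ 6 = y\<^sup>2"
    by (simp_all add: x_def y_def power_divide flip: power_mult)
  have *: "(3 / T ^ 4) * (t - t\<^sub>0) \<le> y - x"
  proof -
    have "t\<^sub>0 ^ 3 * t ^ 3 * 3 * (t - t\<^sub>0) \<le> t ^ 4 * (t ^ 3 - t\<^sub>0 ^ 3)"
    proof -
      have "t ^ 4 * (t ^ 3 - t\<^sub>0 ^ 3) - t\<^sub>0 ^ 3 * t ^ 3 * 3 * (t - t\<^sub>0)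
         = t ^ 3 * (t - t\<^sub>0)\<^sup>2 * (t\<^sup>2 + 2 * t * t\<^sub>0 + 3 * t\<^sub>0\<^sup>2)" by algebra
      also have "\<dots> \<ge> 0" using assms t by (intro mult_nonneg_nonneg) auto
      finally show ?thesis by simp
    qed
    then have "(3 / t ^ 4) * (t - t\<^sub>0) \<le> y - x"
      unfolding x_def y_def using t assms by (simp add: field_simps)
    moreover have "(3 / T ^ 4) * (t - t\<^sub>0) \<le> (3 / t ^ 4) * (t - t\<^sub>0)"
      using assms t by (intro mult_right_mono divide_left_mono power_mono) auto
    ultimately show ?thesis by linarith
  qed
  have "(1 / t ^ 6 - \<beta> / t ^ 3) - (1 / t\<^sub>0 ^ 6 - \<beta> / t\<^sub>0 ^ 3) = (y - x) * (\<beta> - (x + y))"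
  proof -
    have "\<beta> / t ^ 3 = \<beta> * x" "\<beta> / t\<^sub>0 ^ 3 = \<beta> * y" by (simp_all add: x_def y_def)
    then show ?thesis unfolding sq by (simp add: power2_eq_square algebra_simps)
  qed
  also have "\<dots> \<ge> (y - x) * (\<beta> - 2 * x\<^sub>0)"
    using xy assms unfolding y_def by (intro mult_left_mono) auto
  finally show ?thesis
    using mult_left_mono[OF *, of "\<beta> - 2 * x\<^sub>0"] assms(5)
    unfolding mult.assoc mult.commute[of "y - x"] by linarith
qed

lemma lj_mono:
  fixes t t\<^sub>0 \<beta> :: real
  assumes "0 < t\<^sub>0" "t\<^sub>0 \<le> t" "1 / t\<^sub>0 ^ 3 \<le> 1" "2 \<le> \<beta>"
  shows "0 \<le> (1 / t ^ 6 - \<beta> / t ^ 3) - (1 / t\<^sub>0 ^ 6 - \<beta> / t\<^sub>0 ^ 3)"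
proof -
  have "0 \<le> (\<beta> - 2 * 1) * (3 / t ^ 4) * (t - t\<^sub>0)" using assms by (intro mult_nonneg_nonneg) auto
  also have "\<dots> \<le> (1 / t ^ 6 - \<beta> / t ^ 3) - (1 / t\<^sub>0 ^ 6 - \<beta> / t\<^sub>0 ^ 3)"
    using assms by (intro lj_increment) auto
  finally show ?thesis .
qed

text \<open>On the circle the values at (1,1) and (1,-1) have product 4. With p = cosh a, the factor
  p (4 p^2 - 3) is cosh (3 a), the Chebyshev polynomial T_3 at p.\<close>

lemma diagonal_terms:
  fixes p h \<beta> :: real
  assumes "p\<^sup>2 = 1 + h\<^sup>2"
  shows "1 / (2 * p + 2 * h) ^ 6 + 1 / (2 * p - 2 * h) ^ 6
         - \<beta> * (1 / (2 * p + 2 * h) ^ 3 + 1 / (2 * p - 2 * h) ^ 3)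
       = (p * (4 * p\<^sup>2 - 3))\<^sup>2 / 16 - 1 / 32 - \<beta> * (p * (4 * p\<^sup>2 - 3) / 4)"
proof -
  have prod: "(2 * p + 2 * h) * (2 * p - 2 * h) = 4" using assms by algebra
  then have nz: "2 * p + 2 * h \<noteq> 0" "2 * p - 2 * h \<noteq> 0" by auto
  have S: "(2 * p + 2 * h) ^ 3 + (2 * p - 2 * h) ^ 3 = 16 * (p * (4 * p\<^sup>2 - 3))"
    using assms by algebra
  show ?thesis unfolding inverse_powers_sum[OF nz] prod S by algebra
qed

text \<open>The contribution of the multiples of \<open>(1,0)\<close>, \<open>(0,1)\<close>, \<open>(1,1)\<close>, \<open>(1,-1)\<close>; passing from \<open>b\<close> to
  \<open>\<beta> = b (1 + 2\<^bsup>-6\<^esup> + 3\<^bsup>-6\<^esup> + 4\<^bsup>-6\<^esup>)\<close> accounts for the proper multiples.\<close>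

definition main_part :: "real \<Rightarrow> real \<Rightarrow> real \<Rightarrow> real \<Rightarrow> real" where
  "main_part \<beta> p u h =
     1 / (p + u) ^ 6 + 1 / (p - u) ^ 6 - 2 + (1 / (2 * p + 2 * h) ^ 6 + 1 / (2 * p - 2 * h) ^ 6 - 1 / 32)
     - \<beta> * (1 / (p + u) ^ 3 + 1 / (p - u) ^ 3 - 2 + (1 / (2 * p + 2 * h) ^ 3 + 1 / (2 * p - 2 * h) ^ 3 - 1 / 4))"

text \<open>The last term absorbs all remaining lattice vectors and the inverse sixth powers not contained
  in the main part.\<close>

definition lower :: "real \<Rightarrow> real \<Rightarrow> real \<Rightarrow> real \<Rightarrow> real" where
  "lower \<beta> p u h = main_part \<beta> p u h - (1531/500) * rest_bound (1 / p) (u\<^sup>2) (h\<^sup>2)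
     - (41/5000) * (4 * p ^ 3 - 3 * p - 1)"

lemma lower_arc:
  assumes "1 \<le> p" "p \<le> (2887/2500)" "(31127/10000) \<le> \<beta>" "p\<^sup>2 = 1 + h\<^sup>2"
  shows "(3/100) * h\<^sup>2 \<le> lower \<beta> p 0 h"
proof -
  have h: "h\<^sup>2 = p\<^sup>2 - 1" using assms by simp
  have "lower \<beta> p 0 h = 2 / p ^ 6 - 2 + ((p * (4 * p\<^sup>2 - 3))\<^sup>2 - 1) / 16
           - \<beta> * (2 / p ^ 3 - 2 + (4 * p ^ 3 - 3 * p - 1) / 4)
           - (1531/500) * rest_bound (1 / p) 0 (p\<^sup>2 - 1) - (41/5000) * (4 * p ^ 3 - 3 * p - 1)"
  proof -
    have c: "4 * p ^ 3 - 3 * p = p * (4 * p\<^sup>2 - 3)" by algebra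
    define s6 s3 where "s6 = 1 / (2 * p + 2 * h) ^ 6 + 1 / (2 * p - 2 * h) ^ 6"
      and "s3 = 1 / (2 * p + 2 * h) ^ 3 + 1 / (2 * p - 2 * h) ^ 3"
    have d: "s6 = \<beta> * s3 + (p * (4 * p\<^sup>2 - 3))\<^sup>2 / 16 - 1 / 32 - \<beta> * (p * (4 * p\<^sup>2 - 3) / 4)"
      using diagonal_terms[OF assms(4), of \<beta>] unfolding s6_def s3_def by linarith
    show ?thesis
      unfolding lower_def main_part_def h c s6_def[symmetric] s3_def[symmetric] d
      by (simp add: algebra_simps add_divide_distrib diff_divide_distrib)
  qed
  then show ?thesis using arc_bound[OF assms(1-3)] unfolding h by linarith
qed

text \<open>In the half-plane picture \<open>p\<^sub>0\<close> is the value of \<open>p\<close> at the point of the unit circle with the same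
  \<open>h\<close>; passing from \<open>p\<^sub>0\<close> to \<open>p\<close> at constant \<open>h\<close> is compared with the bound on the unit circle.\<close>

locale reduced_point =
  fixes \<beta> p u h p\<^sub>0 :: real
  assumes beta: "(31127/10000) \<le> \<beta>" "\<beta> \<le> (623/200)"
    and p0: "1 \<le> p\<^sub>0" "p\<^sub>0\<^sup>2 = 1 + h\<^sup>2"
    and p: "p\<^sub>0 \<le> p" "p\<^sup>2 = p\<^sub>0\<^sup>2 + u\<^sup>2"
    and u: "0 \<le> u" and h: "0 \<le> h" "2 * h \<le> p - u"
begin

text \<open>4 h^2 <= (p - u)^2 <= (p - u) (p + u) = 1 + h^2 gives h <= 1 / sqrt 3, with equality for
  the hexagonal lattice; the constant is rounded up.\<close>

lemma h_le: "h \<le> (2887/5000)"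
proof -
  have "(p - u) * (p + u) = p\<^sub>0\<^sup>2" using p by algebra
  moreover have "(p - u) * (p - u) \<le> (p - u) * (p + u)" using u h by (intro mult_left_mono) auto
  moreover have "(2 * h) * (2 * h) \<le> (p - u) * (p - u)" using h by (intro mult_mono) auto
  ultimately have "h\<^sup>2 \<le> 1 / 3" using p0 by (simp add: power2_eq_square)
  also have "\<dots> \<le> (2887/5000)\<^sup>2" by (simp add: power2_eq_square)
  finally show ?thesis by (rule power2_le_imp_le) auto
qed

lemma p0_le: "p\<^sub>0 \<le> (2887/2500)"
proof (rule power2_le_imp_le)
  have "h\<^sup>2 \<le> (2887/5000)\<^sup>2" using h_le h by (intro power_mono) auto
  then show "p\<^sub>0\<^sup>2 \<le> (2887/2500)\<^sup>2" unfolding p0(2) by (simp add: power2_eq_square)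
qed auto

definition X :: real where "X = 2 * (p - p\<^sub>0) * (2 * p + p\<^sub>0)\<^sup>2"

lemma X_nonneg: "0 \<le> X"
  unfolding X_def using p by simp

lemma X_le: "X \<le> 9 * p * u\<^sup>2"
proof -
  have U: "u\<^sup>2 = p\<^sup>2 - p\<^sub>0\<^sup>2" using p by simp
  have "9 * p * u\<^sup>2 - X = (p - p\<^sub>0)\<^sup>2 * (p + 2 * p\<^sub>0)"
    unfolding U X_def by algebra
  also have "\<dots> \<ge> 0" using p p0 by simp
  finally show ?thesis by simp
qed

lemma t0: "0 < 2 * p\<^sub>0 - 2 * h" "1 / (2 * p\<^sub>0 - 2 * h) = (p\<^sub>0 + h) / 2"
proof -
  have "(p\<^sub>0 - h) * (p\<^sub>0 + h) = 1" using p0 by algebra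
  moreover have "p\<^sub>0 + h > 0" using p0 h by simp
  ultimately have "p\<^sub>0 - h > 0" by (metis zero_less_mult_pos2 zero_less_one)
  then show "0 < 2 * p\<^sub>0 - 2 * h" by simp
  show "1 / (2 * p\<^sub>0 - 2 * h) = (p\<^sub>0 + h) / 2"
    using \<open>(p\<^sub>0 - h) * (p\<^sub>0 + h) = 1\<close> \<open>p\<^sub>0 - h > 0\<close> by (simp add: field_simps)
qed

lemma x0: "1 / (2 * p\<^sub>0 - 2 * h) ^ 3 = ((p\<^sub>0 + h) / 2) ^ 3"
  unfolding t0(2)[symmetric] by (simp add: power_one_over)

text \<open>The changes at (1,0), (0,1) and (1,-1) are kept exactly, the term of (1,1) increases and
  is dropped, and all the rest costs at most a slope times u^2.\<close>

lemma lower_diff: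
  "lower \<beta> p u h - lower \<beta> p\<^sub>0 0 h \<ge>
     X * (X + 4 * p\<^sub>0 ^ 3 - \<beta> * p\<^sub>0 ^ 6) / p\<^sub>0 ^ 12
     + ((1 / (2 * p - 2 * h) ^ 6 - \<beta> / (2 * p - 2 * h) ^ 3)
         - (1 / (2 * p\<^sub>0 - 2 * h) ^ 6 - \<beta> / (2 * p\<^sub>0 - 2 * h) ^ 3))
     - u\<^sup>2 * ((1531/500) * rest_slope (1 / p\<^sub>0) (u\<^sup>2) (h\<^sup>2) + (123/2500) * p)"
proof -
  have "p\<^sub>0 > 0" using p0 by simp
  have "(2 * p\<^sub>0 + 2 * h) ^ 3 \<ge> 1 ^ 3" using p0 h by (intro power_mono) auto
  then have "1 / (2 * p\<^sub>0 + 2 * h) ^ 3 \<le> 1" using p0 h by simp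
  with lj_mono[of "2 * p\<^sub>0 + 2 * h" "2 * p + 2 * h" \<beta>]
  have "0 \<le> (1 / (2 * p + 2 * h) ^ 6 - \<beta> / (2 * p + 2 * h) ^ 3)
         - (1 / (2 * p\<^sub>0 + 2 * h) ^ 6 - \<beta> / (2 * p\<^sub>0 + 2 * h) ^ 3)"
    using p0 h p beta by simp
  moreover have "rest_bound (1 / p) (u\<^sup>2) (h\<^sup>2) - rest_bound (1 / p\<^sub>0) 0 (h\<^sup>2)
      \<le> u\<^sup>2 * rest_slope (1 / p\<^sub>0) (u\<^sup>2) (h\<^sup>2)"
    using p0 p by (intro rest_bound_diff) (auto simp: frac_le)
  moreover note cubic_diff[OF \<open>p\<^sub>0 > 0\<close> p]
  moreover have "main_part \<beta> p u h - main_part \<beta> p\<^sub>0 0 h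
     = X * (X + 4 * p\<^sub>0 ^ 3 - \<beta> * p\<^sub>0 ^ 6) / p\<^sub>0 ^ 12
       + ((1 / (2 * p - 2 * h) ^ 6 - \<beta> / (2 * p - 2 * h) ^ 3)
         - (1 / (2 * p\<^sub>0 - 2 * h) ^ 6 - \<beta> / (2 * p\<^sub>0 - 2 * h) ^ 3))
       + ((1 / (2 * p + 2 * h) ^ 6 - \<beta> / (2 * p + 2 * h) ^ 3)
         - (1 / (2 * p\<^sub>0 + 2 * h) ^ 6 - \<beta> / (2 * p\<^sub>0 + 2 * h) ^ 3))"
    using axis_terms[OF \<open>p\<^sub>0 > 0\<close> p(2), of \<beta>] axis_terms[OF \<open>p\<^sub>0 > 0\<close>, of p\<^sub>0 0 \<beta>]
    unfolding main_part_def X_def by (simp add: right_diff_distrib distrib_left)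
  moreover have "u\<^sup>2 * ((1531/500) * rest_slope (1 / p\<^sub>0) (u\<^sup>2) (h\<^sup>2) + (123/2500) * p)
     = (1531/500) * (u\<^sup>2 * rest_slope (1 / p\<^sub>0) (u\<^sup>2) (h\<^sup>2)) + (41/5000) * (6 * p * u\<^sup>2)" by algebra
  moreover have "e + t - w \<le> (m - (1531/500) * r - (41/5000) * c) - (m0 - (1531/500) * r0 - (41/5000) * c0)"
    if "0 \<le> f" "r - r0 \<le> s" "c - c0 \<le> k" "m - m0 = e + t + f" "w = (1531/500) * s + (41/5000) * k"
    for e t w m r c m0 r0 c0 f s k :: real
    using that by linarith
  ultimately show ?thesis unfolding lower_def power_zero_numeral by blast
qed

lemma lower_arc_base: "(3/100) * h\<^sup>2 \<le> lower \<beta> p\<^sub>0 0 h"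
  using lower_arc[of p\<^sub>0 \<beta> h] p0 p0_le beta by auto

lemma increment_pos:
  "0 \<le> (1 / (2 * p - 2 * h) ^ 6 - \<beta> / (2 * p - 2 * h) ^ 3)
         - (1 / (2 * p\<^sub>0 - 2 * h) ^ 6 - \<beta> / (2 * p\<^sub>0 - 2 * h) ^ 3)"
proof -
  have "((p\<^sub>0 + h) / 2) ^ 3 \<le> 1 ^ 3" using p0 h h_le p0_le by (intro power_mono) auto
  then have "1 / (2 * p\<^sub>0 - 2 * h) ^ 3 \<le> 1" unfolding x0 by simp
  with lj_mono[of "2 * p\<^sub>0 - 2 * h" "2 * p - 2 * h" \<beta>] t0
  show ?thesis
    using p0 h p beta by simp
qed

text \<open>This range contains the cusp, so \<open>p\<close> is unbounded. Here (1,0) and (0,1)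
  suffice: their first-order gain stays above 9/25, and the final comparison of polynomials in
  \<delta> holds coefficient by coefficient.\<close>

lemma lower_nonneg_small:
  assumes "h \<le> (173/500)"
  shows "0 \<le> lower \<beta> p u h"
proof -
  define \<delta> where "\<delta> = p - p\<^sub>0"
  have \<delta>: "0 \<le> \<delta>" "p = p\<^sub>0 + \<delta>" using p by (auto simp: \<delta>_def)
  have H: "h\<^sup>2 \<le> (3/25)"
  proof -
    have "h\<^sup>2 \<le> (173/500)\<^sup>2" using assms h by (intro power_mono) auto
    then show ?thesis by (simp add: power2_eq_square)
  qed
  have P: "p\<^sub>0 \<le> (1323/1250)"
  proof (rule power2_le_imp_le)
    show "p\<^sub>0\<^sup>2 \<le> (1323/1250)\<^sup>2" unfolding p0(2) using H by (simp add: power2_eq_square)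
  qed auto
  define y where "y = p\<^sub>0 ^ 3"
  have y: "1 \<le> y" "y \<le> (11857/10000)"
  proof -
    show "1 \<le> y" unfolding y_def using p0 by simp
    have "y \<le> (1323/1250) ^ 3" unfolding y_def using p0 P by (intro power_mono) auto
    then show "y \<le> (11857/10000)" by (simp add: power3_eq_cube)
  qed
  \<comment> \<open>The chord of y^2 over the range of y makes the next bound linear in y.\<close>
  have "0 \<le> (y - 1) * ((11857/10000) - y)" using y by simp
  then have y2: "y\<^sup>2 \<le> (21857/10000) * y - (11857/10000)" by (simp add: power2_eq_square field_simps)
  have Q: "(9/25) \<le> 4 * p\<^sub>0 ^ 3 - \<beta> * p\<^sub>0 ^ 6"
  proof -
    have "\<beta> * y\<^sup>2 \<le> (623/200) * y\<^sup>2" using beta by (intro mult_right_mono) auto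
    moreover have "p\<^sub>0 ^ 6 = y\<^sup>2" by (simp add: y_def flip: power_mult)
    ultimately show ?thesis using y2 y unfolding y_def[symmetric] by (simp only:)
  qed
  define M where "M = 9 + 12 * \<delta> + 4 * \<delta>\<^sup>2"
  have M: "0 < M" using \<delta> by (simp add: M_def add_pos_nonneg)
  have X: "2 * \<delta> * M \<le> X"
  proof -
    have "M = (3 + 2 * \<delta>)\<^sup>2" unfolding M_def by algebra
    also have "\<dots> \<le> (2 * p + p\<^sub>0)\<^sup>2" using \<delta> p0 by (intro power_mono) auto
    finally show ?thesis unfolding X_def \<delta>_def[symmetric] using \<delta> by (intro mult_left_mono) auto
  qed
  have k6: "p\<^sub>0 ^ 12 \<le> (987/500)"
  proof -
    have "p\<^sub>0 ^ 12 = (p\<^sub>0\<^sup>2) ^ 6" by (simp flip: power_mult)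
    also have "\<dots> \<le> (28/25) ^ 6" unfolding p0(2) using H by (intro power_mono) auto
    finally show ?thesis by (simp add: power_divide)
  qed
  have E1: "2 * \<delta> * M * (2 * \<delta> * M + (9/25)) / (987/500) \<le> X * (X + 4 * p\<^sub>0 ^ 3 - \<beta> * p\<^sub>0 ^ 6) / p\<^sub>0 ^ 12"
  proof (rule frac_le)
    show "2 * \<delta> * M * (2 * \<delta> * M + (9/25)) \<le> X * (X + 4 * p\<^sub>0 ^ 3 - \<beta> * p\<^sub>0 ^ 6)"
      using X Q \<delta>(1) M X_nonneg by (intro mult_mono) auto
    show "0 \<le> X * (X + 4 * p\<^sub>0 ^ 3 - \<beta> * p\<^sub>0 ^ 6)" using X_nonneg Q by (intro mult_nonneg_nonneg) auto
  qed (use k6 p0 in auto)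
  define V where "V = (1323/625) + \<delta>"
  have V0: "0 \<le> V" unfolding V_def using \<delta>(1) by simp
  have V: "u\<^sup>2 \<le> \<delta> * V"
  proof -
    have "u\<^sup>2 = \<delta> * (2 * p\<^sub>0 + \<delta>)" using p(2) unfolding \<delta>(2) by algebra
    also have "\<dots> \<le> \<delta> * V" unfolding V_def using \<delta> P by (intro mult_left_mono) auto
    finally show ?thesis .
  qed
  have j: "0 \<le> 1 / p\<^sub>0" "1 / p\<^sub>0 \<le> 1" using p0 by auto
  have s: "rest_slope (1 / p\<^sub>0) (u\<^sup>2) (h\<^sup>2) \<le> rest_slope 1 (\<delta> * V) (3/25)"
    using j V H by (intro rest_slope_mono) auto
  have s0: "0 \<le> rest_slope (1 / p\<^sub>0) (u\<^sup>2) (h\<^sup>2)" using j unfolding rest_slope_def by simp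
  have "u\<^sup>2 * ((1531/500) * rest_slope (1 / p\<^sub>0) (u\<^sup>2) (h\<^sup>2) + (123/2500) * p)
     \<le> \<delta> * V * ((1531/500) * rest_slope 1 (\<delta> * V) (3/25) + (123/2500) * ((1323/1250) + \<delta>))"
    using V V0 s s0 \<delta> P p0 by (intro mult_mono add_mono) auto
  also have "\<dots> \<le> 2 * \<delta> * M * (2 * \<delta> * M + (9/25)) / (987/500)"
  proof -
    have "V * ((1531/500) * rest_slope 1 (\<delta> * V) (3/25) + (123/2500) * ((1323/1250) + \<delta>)) \<le> 2 * M * (2 * \<delta> * M + (9/25)) / (987/500)"
    proof -
      have nn: "0 \<le> \<delta> ^ k" for k using \<delta> by simp
      have "V * ((1531/500) * rest_slope 1 (\<delta> * V) (3/25) + (123/2500) * ((1323/1250) + \<delta>))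
          = (44804317473657/30517578125000) + (23647436621880129/6103515625000000) * \<delta> ^ 1
              + (1598053981680779181/381469726562500000) * \<delta> ^ 2
              + (2971437355233657/1220703125000000) * \<delta> ^ 3
              + (403111520721/488281250000) * \<delta> ^ 4 + (101565009/781250000) * \<delta> ^ 5"
              unfolding V_def rest_slope_def power_one by algebra
      moreover have "2 * M * (2 * \<delta> * M + (9/25)) / (987/500) = (1080/329) + (7920/47) * \<delta> ^ 1 + (20640/47) * \<delta> ^ 2
          + (144000/329) * \<delta> ^ 3 + (64000/329) * \<delta> ^ 4 + (32000/987) * \<delta> ^ 5"
        unfolding M_def divide_divide_eq_right by algebra
      ultimately show ?thesis
        using nn[of 2] nn[of 3] nn[of 4] nn[of 5] \<delta>(1) unfolding power_0 power_one_right by linarith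
    qed
    from mult_left_mono[OF this \<delta>(1)] show ?thesis by (simp add: algebra_simps)
  qed
  finally show ?thesis using lower_diff increment_pos E1 lower_arc_base zero_le_power2[of h] by linarith
qed

text \<open>For \<open>h\<close> in \<open>[g, G]\<close> the remaining parameters are rounded bounds: \<open>P\<close> for \<open>p\<^sub>0\<close>, \<open>j\<close> for \<open>1/p\<^sub>0\<close>,
  \<open>y\<close> for \<open>p\<^sub>0\<^bsup>-3\<^esup>\<close>, \<open>T\<close> for \<open>2p - 2h\<close>, \<open>v\<close> for \<open>u\<close>, \<open>q\<close> for \<open>p\<close>, \<open>x\<close> for \<open>(2p\<^sub>0 - 2h)\<^bsup>-3\<^esup>\<close>, and \<open>- e\<close> for the
  slope of the terms of \<open>(1,0)\<close> and \<open>(0,1)\<close>.\<close>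

lemma lower_nonneg_region:
  assumes g: "0 < g" "g \<le> h" "h \<le> G"
    and P: "0 \<le> P" "1 + G\<^sup>2 \<le> P\<^sup>2" and j: "0 \<le> j" "1 \<le> j\<^sup>2 * (1 + g\<^sup>2)"
    and y: "(16/25) \<le> y" "y * P ^ 3 \<le> 1" and T: "1 + g\<^sup>2 \<le> 2 * g * T"
    and v: "T - 2 * g \<le> 2 * v" "0 \<le> v" and q: "P\<^sup>2 + v\<^sup>2 \<le> q\<^sup>2" "0 < q"
    and e: "0 \<le> e" "- e \<le> 4 * y ^ 3 - (623/200) * y\<^sup>2"
    and x: "((P + G) / 2) ^ 3 \<le> x" "2 * x \<le> (31127/10000)"
    and pos: "0 \<le> (3/100) * g\<^sup>2 + v\<^sup>2 * (((31127/10000) - 2 * x) * (3 / T ^ 4) / q - 9 * q * e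
                 - (1531/500) * rest_slope j (v\<^sup>2) (G\<^sup>2) - (123/2500) * q)"
  shows "0 \<le> lower \<beta> p u h"
proof -
  define N where "N = ((31127/10000) - 2 * x) * (3 / T ^ 4) / q - 9 * q * e
                 - (1531/500) * rest_slope j (v\<^sup>2) (G\<^sup>2) - (123/2500) * q"
  have pp: "p\<^sub>0 > 0" "p > 0" using p0 p by auto
  have hpos: "0 < h" using g by simp
  have P': "p\<^sub>0 \<le> P"
  proof (rule power2_le_imp_le[OF _ P(1)])
    have "h\<^sup>2 \<le> G\<^sup>2" using h g by (intro power_mono) auto
    then show "p\<^sub>0\<^sup>2 \<le> P\<^sup>2" unfolding p0(2) using P by simp
  qed
  have gh: "g\<^sup>2 \<le> h\<^sup>2" using g by (intro power_mono) auto
  have j': "1 / p\<^sub>0 \<le> j"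
  proof (rule power2_le_imp_le[OF _ j(1)])
    have "1 \<le> j\<^sup>2 * (1 + h\<^sup>2)" using j(2) gh mult_left_mono[of "1 + g\<^sup>2" "1 + h\<^sup>2" "j\<^sup>2"] by simp
    then show "(1 / p\<^sub>0)\<^sup>2 \<le> j\<^sup>2" using pp unfolding power_divide p0(2) by (simp add: pos_divide_le_eq add_pos_nonneg)
  qed
  have bnd: "(p + u) * (2 * h) \<le> 1 + h\<^sup>2"
  proof -
    have "(p + u) * (2 * h) \<le> (p + u) * (p - u)" using h u pp by (intro mult_left_mono) auto
    also have "\<dots> = 1 + h\<^sup>2" using p p0 by algebra
    finally show ?thesis .
  qed
  \<comment> \<open>(1 + h^2) / (2 h) decreases for h < 1, so its value at \<open>g\<close> serves
    for the whole strip.\<close>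
  have Th: "1 + h\<^sup>2 \<le> 2 * h * T"
  proof -
    have "g * (1 + h\<^sup>2) \<le> h * (1 + g\<^sup>2)"
    proof -
      have "h * (1 + g\<^sup>2) - g * (1 + h\<^sup>2) = (h - g) * (1 - g * h)" by algebra
      moreover have "g * h \<le> 1 * 1" using g h_le by (intro mult_mono) auto
      then have "0 \<le> (h - g) * (1 - g * h)" using g by (intro mult_nonneg_nonneg) auto
      ultimately show ?thesis by linarith
    qed
    also have "\<dots> \<le> h * (2 * g * T)" using T hpos by (intro mult_left_mono) auto
    finally have "g * (1 + h\<^sup>2) \<le> g * (2 * h * T)" by (simp add: algebra_simps)
    then show ?thesis using g(1) by simp
  qed
  have puT: "p + u \<le> T"
  proof -
    have "(p + u) * (2 * h) \<le> T * (2 * h)" using bnd Th by (simp add: algebra_simps)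
    then show ?thesis using hpos by simp
  qed
  \<comment> \<open>For fixed h the largest p lies on the edge p - u = 2 h, where 2 p - 2 h equals p
    + u; hence the same bound \<open>T\<close>.\<close>
  have tT: "2 * p - 2 * h \<le> T"
  proof -
    have "(T - (2 * p - 2 * h)) * (2 * h) \<ge> 0"
    proof -
      have "2 * p * (2 * h) \<le> 1 + h\<^sup>2 + (2 * h)\<^sup>2"
      proof -
        have "(p - u - 2 * h) * (p + u - 2 * h) \<ge> 0" using h u by (intro mult_nonneg_nonneg) auto
        moreover have "(p - u - 2 * h) * (p + u - 2 * h) = 1 + h\<^sup>2 - 2 * p * (2 * h) + (2 * h)\<^sup>2"
          using p p0 by algebra
        ultimately show ?thesis by simp
      qed
      then show ?thesis using Th by (simp add: algebra_simps power2_eq_square)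
    qed
    then show ?thesis using hpos by (simp add: zero_le_mult_iff)
  qed
  have uv: "u \<le> v" using puT h v g by linarith
  then have uv2: "u\<^sup>2 \<le> v\<^sup>2" using u by (intro power_mono) auto
  have pq: "p \<le> q"
  proof (rule power2_le_imp_le)
    have "p\<^sub>0\<^sup>2 \<le> P\<^sup>2" using P' pp by (intro power_mono) auto
    then show "p\<^sup>2 \<le> q\<^sup>2" unfolding p(2) using uv2 q by simp
  qed (use q in auto)
  have Tpos: "0 < T" using puT u pp by simp
  have E1: "- (9 * q * e) * u\<^sup>2 \<le> X * (X + 4 * p\<^sub>0 ^ 3 - \<beta> * p\<^sub>0 ^ 6) / p\<^sub>0 ^ 12"
  proof -
    define z where "z = 1 / p\<^sub>0 ^ 3"
    have z: "y \<le> z"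
    proof -
      have "y * p\<^sub>0 ^ 3 \<le> y * P ^ 3" using P' pp y by (intro mult_left_mono power_mono) auto
      with y(2) have "y * p\<^sub>0 ^ 3 \<le> 1" by linarith
      then show ?thesis unfolding z_def using pp by (simp add: pos_le_divide_eq)
    qed
    \<comment> \<open>The function 4 z^3 - (623/200) z^2 increases from 16/25 on, so the lower bound
      \<open>y\<close> of \<open>z\<close> may be inserted.\<close>
    have "4 * z ^ 3 - (623/200) * z\<^sup>2 - (4 * y ^ 3 - (623/200) * y\<^sup>2)
        = (z - y) * ((z + y) * (3 * (z + y) - (623/200)) + (z - y)\<^sup>2)" by algebra
    also have "\<dots> \<ge> 0" using z y by (intro mult_nonneg_nonneg add_nonneg_nonneg) auto
    finally have "- e \<le> 4 * z ^ 3 - (623/200) * z\<^sup>2" using e by linarith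
    also have "\<dots> \<le> 4 * z ^ 3 - \<beta> * z\<^sup>2" using mult_right_mono[OF beta(2) zero_le_power2[of z]] by linarith
    finally have ez: "- e \<le> 4 * z ^ 3 - \<beta> * z\<^sup>2" .
    have "X * (X + 4 * p\<^sub>0 ^ 3 - \<beta> * p\<^sub>0 ^ 6) / p\<^sub>0 ^ 12
      = X\<^sup>2 / p\<^sub>0 ^ 12 + X * (4 * z ^ 3 - \<beta> * z\<^sup>2)"
    proof -
      define w where "w = p\<^sub>0 ^ 3"
      have "w \<noteq> 0" using pp by (simp add: w_def)
      have w: "p\<^sub>0 ^ 6 = w\<^sup>2" "p\<^sub>0 ^ 12 = w ^ 4" by (simp_all add: w_def flip: power_mult)
      show ?thesis unfolding z_def w w_def[symmetric] using \<open>w \<noteq> 0\<close>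
        by (simp add: field_simps power2_eq_square power3_eq_cube power4_eq_xxxx)
    qed
    also have "\<dots> \<ge> X * (- e)" using mult_left_mono[OF ez X_nonneg] by (simp add: add_increasing)
    finally have "X * (- e) \<le> X * (X + 4 * p\<^sub>0 ^ 3 - \<beta> * p\<^sub>0 ^ 6) / p\<^sub>0 ^ 12" .
    moreover have "X * e \<le> 9 * q * u\<^sup>2 * e"
    proof -
      have "X \<le> 9 * q * u\<^sup>2" using X_le mult_right_mono[of "9 * p" "9 * q" "u\<^sup>2"] pq by simp
      then show ?thesis using e by (intro mult_right_mono) auto
    qed
    ultimately show ?thesis by (simp add: algebra_simps)
  qed
  have E2: "((31127/10000) - 2 * x) * (3 / T ^ 4) / q * u\<^sup>2 \<le> (1 / (2 * p - 2 * h) ^ 6 - \<beta> / (2 * p - 2 * h) ^ 3)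
         - (1 / (2 * p\<^sub>0 - 2 * h) ^ 6 - \<beta> / (2 * p\<^sub>0 - 2 * h) ^ 3)"
  proof -
    have "((p\<^sub>0 + h) / 2) ^ 3 \<le> ((P + G) / 2) ^ 3" using P' g pp h by (intro power_mono) auto
    then have "1 / (2 * p\<^sub>0 - 2 * h) ^ 3 \<le> x" unfolding x0 using x by simp
    from lj_increment[OF t0(1) _ tT this, of \<beta>]
    have *: "(\<beta> - 2 * x) * (3 / T ^ 4) * (2 * p - 2 * h - (2 * p\<^sub>0 - 2 * h)) \<le>
        (1 / (2 * p - 2 * h) ^ 6 - \<beta> / (2 * p - 2 * h) ^ 3)
         - (1 / (2 * p\<^sub>0 - 2 * h) ^ 6 - \<beta> / (2 * p\<^sub>0 - 2 * h) ^ 3)"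
      using p x beta by simp
    have "u\<^sup>2 / q \<le> 2 * p - 2 * h - (2 * p\<^sub>0 - 2 * h)"
    proof -
      have "u\<^sup>2 = (p - p\<^sub>0) * (p + p\<^sub>0)" using p(2) by algebra
      also have "\<dots> \<le> (p - p\<^sub>0) * (2 * q)" using p pq by (intro mult_left_mono) auto
      finally show ?thesis using q by (simp add: field_simps)
    qed
    then have "((31127/10000) - 2 * x) * (3 / T ^ 4) * (u\<^sup>2 / q) \<le> (\<beta> - 2 * x) * (3 / T ^ 4) * (2 * p - 2 * h - (2 * p\<^sub>0 - 2 * h))"
      using x beta Tpos q by (intro mult_mono mult_right_mono) auto
    moreover have "((31127/10000) - 2 * x) * (3 / T ^ 4) / q * u\<^sup>2 = ((31127/10000) - 2 * x) * (3 / T ^ 4) * (u\<^sup>2 / q)" by simp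
    ultimately show ?thesis using * by linarith
  qed
  have s: "rest_slope (1 / p\<^sub>0) (u\<^sup>2) (h\<^sup>2) \<le> rest_slope j (v\<^sup>2) (G\<^sup>2)"
    using j' uv u pp g h by (intro rest_slope_mono power_mono) auto
  have R: "u\<^sup>2 * ((1531/500) * rest_slope (1 / p\<^sub>0) (u\<^sup>2) (h\<^sup>2) + (123/2500) * p)
       \<le> u\<^sup>2 * ((1531/500) * rest_slope j (v\<^sup>2) (G\<^sup>2) + (123/2500) * q)"
    using s pq by (intro mult_left_mono add_mono) auto
  have "lower \<beta> p u h \<ge> (3/100) * g\<^sup>2 + u\<^sup>2 * N"
    using lower_diff lower_arc_base E1 E2 R gh unfolding N_def by (simp add: algebra_simps)
  \<comment> \<open>The expression is linear in u^2; if \<open>N\<close> is negative, the reserve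
    from the circle has to pay at the end point v^2.\<close>
  moreover have "(3/100) * g\<^sup>2 + u\<^sup>2 * N \<ge> 0"
  proof (cases "N \<ge> 0")
    case False
    then have "u\<^sup>2 * N \<ge> v\<^sup>2 * N" using uv2 by (intro mult_right_mono_neg) auto
    then show ?thesis using pos unfolding N_def[symmetric] by linarith
  qed simp
  ultimately show ?thesis by linarith
qed

text \<open>Each tuple holds end point values of its strip, rounded in the safe direction. Up to h =
  2/5 the axis vectors do not lose yet, hence \<open>e = 0\<close> in the first tuple.\<close>

lemma lower_nonneg: "0 \<le> lower \<beta> p u h"
proof -
  consider (0) "h \<le> (173/500)"
    | (1) "(173/500) \<le> h" "h \<le> (2/5)"
    | (2) "(2/5) \<le> h" "h \<le> (447/1000)"
    | (3) "(447/1000) \<le> h" "h \<le> (473/1000)"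
    | (4) "(473/1000) \<le> h" "h \<le> (1/2)"
    | (5) "(1/2) \<le> h" "h \<le> (53/100)"
    | (6) "(53/100) \<le> h" "h \<le> (2887/5000)"
    using h_le by linarith
  then show ?thesis
  proof cases
    case 0 then show ?thesis by (rule lower_nonneg_small)
  next
    case 1 then show ?thesis
      by (intro lower_nonneg_region[where g = "(173/500)" and G = "(2/5)" and P = "(10771/10000)" and j = "(9451/10000)"
         and y = "(4001/5000)" and T = "(16181/10000)" and v = "(4631/10000)" and q = "(469/400)" and e = "(0/1)" and x = "(4029/10000)"])
         (simp_all add: rest_slope_def power_divide)
  next
    case 2 then show ?thesis
      by (intro lower_nonneg_region[where g = "(2/5)" and G = "(447/1000)" and P = "(5477/5000)" and j = "(1857/2000)"
         and y = "(951/1250)" and T = "(29/20)" and v = "(13/40)" and q = "(5713/5000)" and e = "(26/625)" and x = "(4587/10000)"])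
         (simp_all add: rest_slope_def power_divide)
  next
    case 3 then show ?thesis
      by (intro lower_nonneg_region[where g = "(447/1000)" and G = "(473/1000)" and P = "(11063/10000)" and j = "(913/1000)"
         and y = "(1477/2000)" and T = "(13421/10000)" and v = "(2241/10000)" and q = "(1411/1250)" and e = "(879/10000)" and x = "(1231/2500)"])
         (simp_all add: rest_slope_def power_divide)
  next
    case 4 then show ?thesis
      by (intro lower_nonneg_region[where g = "(473/1000)" and G = "(1/2)" and P = "(11181/10000)" and j = "(113/125)"
         and y = "(3577/5000)" and T = "(1617/1250)" and v = "(869/5000)" and q = "(2829/2500)" and e = "(1297/10000)" and x = "(331/625)"])
         (simp_all add: rest_slope_def power_divide)
  next
    case 5 then show ?thesis
      by (intro lower_nonneg_region[where g = "(1/2)" and G = "(53/100)" and P = "(5659/5000)" and j = "(1789/2000)"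
         and y = "(6897/10000)" and T = "(5/4)" and v = "(1/8)" and q = "(11387/10000)" and e = "(339/2000)" and x = "(5737/10000)"])
         (simp_all add: rest_slope_def power_divide)
  next
    case 6 then show ?thesis
      by (intro lower_nonneg_region[where g = "(53/100)" and G = "(2887/5000)" and P = "(2887/2500)" and j = "(2209/2500)"
         and y = "(6493/10000)" and T = "(3021/2500)" and v = "(371/5000)" and q = "(2893/2500)" and e = "(2183/10000)" and x = "(6497/10000)"])
         (simp_all add: rest_slope_def power_divide)
  qed
qed

end

section \<open>Pairs of reciprocal powers\<close>

text \<open>At a vector of squared length N and at its rotation by a right angle, a form takes the
  values N (p + w) and N (p - w) for some w with w^2 <= p^2 - 1.\<close>

definition recip_sum :: "nat \<Rightarrow> real \<Rightarrow> real \<Rightarrow> real" where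
  "recip_sum k p w = 1 / (p + w) ^ k + 1 / (p - w) ^ k"

context
  fixes p w :: real
  assumes p: "1 \<le> p" and w: "w\<^sup>2 \<le> p\<^sup>2 - 1"
begin

lemma recip_sum_pos: "0 < p + w" "0 < p - w"
proof -
  have "\<bar>w\<bar> < p" using w p by (intro power2_less_imp_less[of "\<bar>w\<bar>" p]) auto
  then show "0 < p + w" "0 < p - w" using p by linarith+
qed

lemma recip_sum_3: "recip_sum 3 p w = 2 * p * (p\<^sup>2 + 3 * w\<^sup>2) / (p\<^sup>2 - w\<^sup>2) ^ 3"
proof -
  have "(p + w) * (p - w) = p\<^sup>2 - w\<^sup>2" "(p + w) ^ 3 + (p - w) ^ 3 = 2 * p * (p\<^sup>2 + 3 * w\<^sup>2)"
    by algebra+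
  then show ?thesis
    using inverse_powers_sum(1)[of "p + w" "p - w"] recip_sum_pos unfolding recip_sum_def by simp
qed

text \<open>The extreme case is w^2 = p^2 - 1, where \<open>p + w\<close> and \<open>p - w\<close>
  are reciprocal and the sum is 2 cosh (3 a) for p = cosh a.\<close>

lemma recip_sum_3_le: "recip_sum 3 p w \<le> 2 * (4 * p ^ 3 - 3 * p)"
proof -
  define y where "y = p\<^sup>2 - w\<^sup>2"
  have y: "1 \<le> y" using w by (simp add: y_def)
  then have y3: "y \<le> y ^ 3" by (simp add: self_le_power)
  have pp: "1 \<le> p\<^sup>2" using p by simp
  have "2 * p * (p\<^sup>2 + 3 * w\<^sup>2) = 2 * p * (4 * p\<^sup>2 - 3 * y)" unfolding y_def by algebra
  also have "\<dots> \<le> 2 * p * ((4 * p\<^sup>2 - 3) * y ^ 3)"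
  proof -
    have "4 * p\<^sup>2 - 3 * y \<le> (4 * p\<^sup>2 - 3) * y"
      using mult_left_mono[of 1 y "4 * p\<^sup>2"] y by (simp add: algebra_simps)
    also have "\<dots> \<le> (4 * p\<^sup>2 - 3) * y ^ 3" using y3 pp by (intro mult_left_mono) auto
    finally show ?thesis using p by (intro mult_left_mono) auto
  qed
  also have "\<dots> = 2 * (4 * p ^ 3 - 3 * p) * y ^ 3" by algebra
  finally show ?thesis unfolding recip_sum_3 y_def[symmetric] using y by (simp add: pos_divide_le_eq)
qed

text \<open>The next two bounds are Taylor polynomials in \<open>w\<^sup>2\<close> whose last coefficient is enlarged so that
  equality holds at the extreme value \<open>w\<^sup>2 = p\<^sup>2 - 1\<close>. Hence, after clearing denominators, the difference
  of both sides is divisible by \<open>p\<^sup>2 - 1 - w\<^sup>2\<close>.\<close>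

lemma recip_sum_3_le_order2:
  "recip_sum 3 p w \<le> 2 * (1 / p) ^ 3 + 12 * (1 / p) ^ 5 * w\<^sup>2
     + (8 * (1 / p) + 10 * (1 / p) ^ 3 + 12 * (1 / p) ^ 5) * w ^ 4"
proof -
  define j W y where "j = 1 / p" and "W = w\<^sup>2" and "y = p\<^sup>2 - w\<^sup>2 - 1"
  have jp: "j * p = 1" and j: "0 < j" using p by (auto simp: j_def)
  have nn: "0 \<le> W" "0 \<le> y" using w by (auto simp: W_def y_def)
  have P: "p\<^sup>2 = W + y + 1" by (simp add: W_def y_def)
  have "0 \<le> W ^ 2 * y * (56 + 146 * y + 132 * y ^ 2 + 50 * y ^ 3 + 8 * y ^ 4 + 68 * W + 126 * W * y
      + 74 * W * y ^ 2 + 16 * W * y ^ 3 + 24 * W ^ 2 + 24 * W ^ 2 * y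
      + 8 * W ^ 2 * y ^ 2)"
    using nn by (intro mult_nonneg_nonneg add_nonneg_nonneg) auto
  also have "\<dots> = (2 * p\<^sup>2 + 12 * W + (8 * (p\<^sup>2)\<^sup>2 + 10 * p\<^sup>2 + 12) * W\<^sup>2) * (y + 1) ^ 3
      - 2 * (p\<^sup>2) ^ 3 * (p\<^sup>2 + 3 * W)"
    unfolding P by algebra
  finally have "0 \<le> j ^ 5 * ((2 * p\<^sup>2 + 12 * W + (8 * (p\<^sup>2)\<^sup>2 + 10 * p\<^sup>2 + 12) * W\<^sup>2) * (y + 1) ^ 3
      - 2 * (p\<^sup>2) ^ 3 * (p\<^sup>2 + 3 * W))"
    using j by simp
  also have "\<dots> = (2 * j ^ 3 + 12 * j ^ 5 * W + (8 * j + 10 * j ^ 3 + 12 * j ^ 5) * W\<^sup>2) * (y + 1) ^ 3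
      - 2 * p * (p\<^sup>2 + 3 * W)"
  proof -
    have "j ^ 5 * p\<^sup>2 = j ^ 3" "j ^ 5 * (p\<^sup>2)\<^sup>2 = j" "j ^ 5 * (p\<^sup>2) ^ 3 = p"
      using jp by algebra+
    moreover have "j ^ 5 * ((2 * p\<^sup>2 + 12 * W + (8 * (p\<^sup>2)\<^sup>2 + 10 * p\<^sup>2 + 12) * W\<^sup>2) * (y + 1) ^ 3
      - 2 * (p\<^sup>2) ^ 3 * (p\<^sup>2 + 3 * W)) = (2 * (j ^ 5 * p\<^sup>2) + 12 * j ^ 5 * W + (8 * (j ^ 5 * (p\<^sup>2)\<^sup>2)
        + 10 * (j ^ 5 * p\<^sup>2) + 12 * j ^ 5) * W\<^sup>2) * (y + 1) ^ 3 - 2 * (j ^ 5 * (p\<^sup>2) ^ 3) * (p\<^sup>2 + 3 * W)"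
      by (simp add: algebra_simps)
    ultimately show ?thesis by simp
  qed
  finally have "2 * p * (p\<^sup>2 + 3 * W) \<le> (2 * j ^ 3 + 12 * j ^ 5 * W + (8 * j + 10 * j ^ 3 + 12 * j ^ 5) * W\<^sup>2) * (y + 1) ^ 3"
    by simp
  then have "2 * p * (p\<^sup>2 + 3 * W) / (y + 1) ^ 3 \<le> 2 * j ^ 3 + 12 * j ^ 5 * W + (8 * j + 10 * j ^ 3 + 12 * j ^ 5) * W\<^sup>2"
    using nn by (simp add: pos_divide_le_eq)
  moreover have "p\<^sup>2 - w\<^sup>2 = y + 1" "W\<^sup>2 = w ^ 4" by (simp_all add: y_def W_def flip: power_mult)
  ultimately show ?thesis unfolding recip_sum_3 j_def W_def by simp
qed

lemma recip_sum_3_le_order3: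
  "recip_sum 3 p w \<le> 2 * (1 / p) ^ 3 + 12 * (1 / p) ^ 5 * w\<^sup>2 + 30 * (1 / p) ^ 7 * w ^ 4
     + (8 * (1 / p) ^ 3 + 18 * (1 / p) ^ 5 + 30 * (1 / p) ^ 7) * w ^ 6"
proof -
  define j W y where "j = 1 / p" and "W = w\<^sup>2" and "y = p\<^sup>2 - w\<^sup>2 - 1"
  have jp: "j * p = 1" and j: "0 < j" using p by (auto simp: j_def)
  have nn: "0 \<le> W" "0 \<le> y" using w by (auto simp: W_def y_def)
  have P: "p\<^sup>2 = W + y + 1" by (simp add: W_def y_def)
  have "0 \<le> W ^ 3 * y * (90 + 222 * y + 182 * y ^ 2 + 58 * y ^ 3 + 8 * y ^ 4 + 84 * W + 150 * W * y
      + 82 * W * y ^ 2 + 16 * W * y ^ 3 + 24 * W ^ 2 + 24 * W ^ 2 * y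
      + 8 * W ^ 2 * y ^ 2)"
    using nn by (intro mult_nonneg_nonneg add_nonneg_nonneg) auto
  also have "\<dots> = (2 * (p\<^sup>2)\<^sup>2 + 12 * p\<^sup>2 * W + 30 * W\<^sup>2 + (8 * (p\<^sup>2)\<^sup>2 + 18 * p\<^sup>2 + 30) * W ^ 3) * (y + 1) ^ 3
      - 2 * (p\<^sup>2) ^ 4 * (p\<^sup>2 + 3 * W)"
    unfolding P by algebra
  finally have "0 \<le> j ^ 7 * ((2 * (p\<^sup>2)\<^sup>2 + 12 * p\<^sup>2 * W + 30 * W\<^sup>2 + (8 * (p\<^sup>2)\<^sup>2 + 18 * p\<^sup>2 + 30) * W ^ 3) * (y + 1) ^ 3
      - 2 * (p\<^sup>2) ^ 4 * (p\<^sup>2 + 3 * W))"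
    using j by simp
  also have "\<dots> = (2 * j ^ 3 + 12 * j ^ 5 * W + 30 * j ^ 7 * W\<^sup>2 + (8 * j ^ 3 + 18 * j ^ 5 + 30 * j ^ 7) * W ^ 3) * (y + 1) ^ 3
      - 2 * p * (p\<^sup>2 + 3 * W)"
  proof -
    have "j ^ 7 * p\<^sup>2 = j ^ 5" "j ^ 7 * (p\<^sup>2)\<^sup>2 = j ^ 3" "j ^ 7 * (p\<^sup>2) ^ 4 = p"
      using jp by algebra+
    moreover have "j ^ 7 * ((2 * (p\<^sup>2)\<^sup>2 + 12 * p\<^sup>2 * W + 30 * W\<^sup>2 + (8 * (p\<^sup>2)\<^sup>2 + 18 * p\<^sup>2 + 30) * W ^ 3) * (y + 1) ^ 3
      - 2 * (p\<^sup>2) ^ 4 * (p\<^sup>2 + 3 * W)) = (2 * (j ^ 7 * (p\<^sup>2)\<^sup>2) + 12 * (j ^ 7 * p\<^sup>2) * W + 30 * j ^ 7 * W\<^sup>2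
        + (8 * (j ^ 7 * (p\<^sup>2)\<^sup>2) + 18 * (j ^ 7 * p\<^sup>2) + 30 * j ^ 7) * W ^ 3) * (y + 1) ^ 3
        - 2 * (j ^ 7 * (p\<^sup>2) ^ 4) * (p\<^sup>2 + 3 * W)"
      by (simp add: algebra_simps)
    ultimately show ?thesis by simp
  qed
  finally have "2 * p * (p\<^sup>2 + 3 * W) \<le> (2 * j ^ 3 + 12 * j ^ 5 * W + 30 * j ^ 7 * W\<^sup>2 + (8 * j ^ 3 + 18 * j ^ 5 + 30 * j ^ 7) * W ^ 3) * (y + 1) ^ 3"
    by simp
  then have "2 * p * (p\<^sup>2 + 3 * W) / (y + 1) ^ 3 \<le> 2 * j ^ 3 + 12 * j ^ 5 * W + 30 * j ^ 7 * W\<^sup>2 + (8 * j ^ 3 + 18 * j ^ 5 + 30 * j ^ 7) * W ^ 3"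
    using nn by (simp add: pos_divide_le_eq)
  moreover have "p\<^sup>2 - w\<^sup>2 = y + 1" "W\<^sup>2 = w ^ 4" "W ^ 3 = w ^ 6" by (simp_all add: y_def W_def flip: power_mult)
  ultimately show ?thesis unfolding recip_sum_3 j_def W_def by simp
qed

text \<open>The sum is at least twice the geometric mean of its terms, hence at least 2 / p^6, which
  Bernoulli bounds below by 2 - 12 (p - 1); and 4 p^3 - 3 p - 1 >= 9 (p - 1).\<close>

lemma recip_sum_6_ge: "2 - 4 / 3 * (4 * p ^ 3 - 3 * p - 1) \<le> recip_sum 6 p w"
proof -
  define c where "c = (p + w) * (p - w)"
  have c: "0 < c" "c \<le> p\<^sup>2"
    using recip_sum_pos mult_pos_pos[of "p + w" "p - w"] zero_le_square[of w]
    unfolding c_def by (simp_all add: power2_eq_square algebra_simps)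
  have "2 - 4 / 3 * (4 * p ^ 3 - 3 * p - 1) \<le> 2 - 12 * (p - 1)"
  proof -
    have "0 \<le> 4 * (p - 1)\<^sup>2 * (p + 2)" using p by simp
    also have "\<dots> = 4 * p ^ 3 - 3 * p - 1 - 9 * (p - 1)" by algebra
    finally show ?thesis by (simp add: field_simps)
  qed
  also have "\<dots> \<le> 2 / p ^ 6"
  proof -
    have "1 + real 6 * (1 / p - 1) \<le> (1 + (1 / p - 1)) ^ 6"
      using p by (intro Bernoulli_inequality) simp
    moreover have "1 - p \<le> 1 / p - 1"
    proof -
      have "1 / p - 1 - (1 - p) = (p - 1)\<^sup>2 / p" using p by (simp add: field_simps power2_eq_square)
      moreover have "0 \<le> (p - 1)\<^sup>2 / p" using p by simp
      ultimately show ?thesis by linarith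
    qed
    ultimately show ?thesis by (simp add: power_one_over)
  qed
  also have "\<dots> = 2 / (p\<^sup>2) ^ 3" by (simp flip: power_mult)
  also have "\<dots> \<le> 2 / c ^ 3" using c p by (intro divide_left_mono power_mono mult_pos_pos) auto
  also have "\<dots> \<le> recip_sum 6 p w"
  proof -
    have "0 \<le> (1 / (p + w) ^ 3 - 1 / (p - w) ^ 3)\<^sup>2" by simp
    also have "\<dots> = 1 / (p + w) ^ 6 + 1 / (p - w) ^ 6 - 2 / c ^ 3"
      unfolding c_def by (simp add: power2_diff power_divide power_mult_distrib flip: power_mult)
    finally show ?thesis unfolding recip_sum_def by simp
  qed
  finally show ?thesis .
qed

end

text \<open>Origin of the constants of \<open>rest_bound\<close>. The weights are 5^-3 + 20^-3 for
  (2,1) with its double, 10^-3 for (3,1) and 13^-3 for (3,2); the fractions in fifths and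
  thirteenths are (m^2 - n^2) / N and 2 m n / N with N = m^2 + n^2. Adding both signs cancels the
  odd powers. The heaviest vector, (2,1), gets the expansion of higher order.\<close>

lemma rest_bound_weighted:
  fixes j u h :: real
  assumes "0 \<le> j" "j \<le> 1"
  defines "T \<equiv> \<lambda>x y. (4 * j ^ 3 - 4) + 12 * j ^ 5 * (x\<^sup>2 + y\<^sup>2)"
  shows "65 / 8000 * (T ((3 * u + 4 * h) / 5) ((3 * u - 4 * h) / 5)
            + 30 * j ^ 7 * (((3 * u + 4 * h) / 5) ^ 4 + ((3 * u - 4 * h) / 5) ^ 4)
            + (8 * j ^ 3 + 18 * j ^ 5 + 30 * j ^ 7) * (((3 * u + 4 * h) / 5) ^ 6 + ((3 * u - 4 * h) / 5) ^ 6))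
       + 1 / 1000 * (T ((4 * u + 3 * h) / 5) ((4 * u - 3 * h) / 5)
            + (8 * j + 10 * j ^ 3 + 12 * j ^ 5) * (((4 * u + 3 * h) / 5) ^ 4 + ((4 * u - 3 * h) / 5) ^ 4))
       + 1 / 2197 * (T ((5 * u + 12 * h) / 13) ((5 * u - 12 * h) / 13)
            + (8 * j + 10 * j ^ 3 + 12 * j ^ 5) * (((5 * u + 12 * h) / 13) ^ 4 + ((5 * u - 12 * h) / 13) ^ 4))
     \<le> rest_bound j (u\<^sup>2) (h\<^sup>2)"
proof -
  define U H where "U = u\<^sup>2" and "H = h\<^sup>2"
  have nn: "0 \<le> U" "0 \<le> H" by (auto simp: U_def H_def)
  have e2: "((x * u + y * h) / z)\<^sup>2 + ((x * u - y * h) / z)\<^sup>2 = 2 * (x\<^sup>2 * U + y\<^sup>2 * H) / z\<^sup>2"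
    for x y z :: real unfolding U_def H_def power_divide add_divide_distrib[symmetric]
    by (rule arg_cong[of _ _ "\<lambda>t. t / z\<^sup>2"]) algebra
  have e4: "((x * u + y * h) / z) ^ 4 + ((x * u - y * h) / z) ^ 4
      = 2 * (x ^ 4 * U\<^sup>2 + 6 * x\<^sup>2 * y\<^sup>2 * (U * H) + y ^ 4 * H\<^sup>2) / z ^ 4"
    for x y z :: real unfolding U_def H_def power_divide add_divide_distrib[symmetric]
    by (rule arg_cong[of _ _ "\<lambda>t. t / z ^ 4"]) algebra
  have e6: "((x * u + y * h) / z) ^ 6 + ((x * u - y * h) / z) ^ 6
      = 2 * (x ^ 6 * U ^ 3 + 15 * x ^ 4 * y\<^sup>2 * (U\<^sup>2 * H) + 15 * x\<^sup>2 * y ^ 4 * (U * H\<^sup>2) + y ^ 6 * H ^ 3) / z ^ 6"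
    for x y z :: real unfolding U_def H_def power_divide add_divide_distrib[symmetric]
    by (rule arg_cong[of _ _ "\<lambda>t. t / z ^ 6"]) algebra
  have "?thesis \<longleftrightarrow> (168381/4394000) * (j ^ 3 - 1) + 24 * j ^ 5 * ((269731909/74258600000) * U + (55209727/9282325000) * H)
     + 60 * j ^ 7 * ((1053/1000000) * U\<^sup>2 + (351/31250) * (U * H) + (52/15625) * H\<^sup>2)
     + (16 * j ^ 3 + 36 * j ^ 5 + 60 * j ^ 7)
       * ((9477/25000000) * U ^ 3 + (3159/312500) * (U\<^sup>2 * H) + (1404/78125) * (U * H\<^sup>2) + (832/390625) * H ^ 3)
     + (16 * j + 20 * j ^ 3 + 24 * j ^ 5) * ((2056780669/4902227890625) * U\<^sup>2 + (8464339836/4902227890625) * (U * H) + (18042629877/39217823125000) * H\<^sup>2) \<le> rest_bound j U H"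
    (is "_ \<longleftrightarrow> ?L \<le> _")
    unfolding T_def e2 e4 e6 U_def[symmetric] H_def[symmetric]
    by (rule arg_cong[of _ _ "\<lambda>t. t \<le> rest_bound j U H"]) (simp, algebra)
  also have "?L \<le> rest_bound j U H"
  proof -
    have "j ^ 3 \<le> 1" using assms by (simp add: power_le_one)
    then have "(168381/4394000) * (j ^ 3 - 1) \<le> (479/12500) * (j ^ 3 - 1)" by (intro mult_right_mono_neg) auto
    moreover have "(269731909/74258600000) * U + (55209727/9282325000) * H \<le> (3633/1000000) * U + (1487/250000) * H"
      using nn by (intro add_mono mult_right_mono) auto
    moreover have "(2056780669/4902227890625) * U\<^sup>2 + (8464339836/4902227890625) * (U * H) + (18042629877/39217823125000) * H\<^sup>2
        \<le> (21/50000) * U\<^sup>2 + (173/100000) * (U * H) + (461/1000000) * H\<^sup>2"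
      using nn by (intro add_mono mult_right_mono) auto
    ultimately show ?thesis unfolding rest_bound_def using assms nn
      by (intro add_mono mult_left_mono) auto
  qed
  finally show ?thesis by simp
qed

section \<open>Forms of discriminant one\<close>

definition qform :: "real \<Rightarrow> real \<Rightarrow> real \<Rightarrow> int \<times> int \<Rightarrow> real" where
  "qform p u h = (\<lambda>(m, n). p * (real_of_int m ^ 2 + real_of_int n ^ 2)
     + u * (real_of_int m ^ 2 - real_of_int n ^ 2) + 2 * h * (real_of_int m * real_of_int n))"

text \<open>A Lennard-Jones potential in the squared distance. As \<open>1 / 0 = 0\<close>, it
  vanishes at 0, so the origin may stay in the sums.\<close>

definition lj :: "real \<Rightarrow> real \<Rightarrow> real" where
  "lj b x = 1 / x ^ 6 - b / x ^ 3"

text \<open>Forms are even, so these four substitutions account for all eight symmetries of the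
  square lattice.\<close>

definition symm :: "(int \<times> int \<Rightarrow> real) \<Rightarrow> int \<times> int \<Rightarrow> real" where
  "symm f = (\<lambda>(m, n). (f (m, n) + f (n, m) + f (m, - n) + f (n, - m)) / 4)"

lemma bij_swap_flip:
  "bij (\<lambda>(m, n). (n, m) :: int \<times> int)" "bij (\<lambda>(m, n). (m, - n) :: int \<times> int)"
  "bij (\<lambda>(m, n). (n, - m) :: int \<times> int)"
proof -
  show "bij (\<lambda>(m, n). (n, m) :: int \<times> int)" by (rule o_bij[of "\<lambda>(m, n). (n, m)"]) auto
  show "bij (\<lambda>(m, n). (m, - n) :: int \<times> int)" by (rule o_bij[of "\<lambda>(m, n). (m, - n)"]) auto
  show "bij (\<lambda>(m, n). (n, - m) :: int \<times> int)" by (rule o_bij[of "\<lambda>(m, n). (- n, m)"]) auto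
qed

lemma infsum_symm:
  assumes "f summable_on UNIV"
  shows "symm f summable_on UNIV" "infsum (symm f) UNIV = infsum f UNIV"
proof -
  note b = bij_swap_flip
  have s: "(\<lambda>v. f ((\<lambda>(m, n). (n, m)) v)) summable_on UNIV"
    "(\<lambda>v. f ((\<lambda>(m, n). (m, - n)) v)) summable_on UNIV"
    "(\<lambda>v. f ((\<lambda>(m, n). (n, - m)) v)) summable_on UNIV"
    using assms b by (simp_all only: summable_on_reindex_bij_betw)
  have eq: "symm f = (\<lambda>v. (1 / 4) * (f v + f ((\<lambda>(m, n). (n, m)) v)
      + f ((\<lambda>(m, n). (m, - n)) v) + f ((\<lambda>(m, n). (n, - m)) v)))"
    by (auto simp: symm_def fun_eq_iff)
  show "symm f summable_on UNIV"
    unfolding eq by (intro summable_on_cmult_right summable_on_add assms s)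
  show "infsum (symm f) UNIV = infsum f UNIV"
    unfolding eq using assms s
    by (simp only: infsum_cmult_right summable_on_add infsum_add infsum_reindex_bij_betw[OF b(1)]
        infsum_reindex_bij_betw[OF b(2)] infsum_reindex_bij_betw[OF b(3)]) simp
qed

lemma (in dihedral) sum_grid_box_4:
  "sum G (grid_box 4) = G (0, 0)
     + 4 * (G (1, 0) + G (2, 0) + G (3, 0) + G (4, 0) + G (1, 1) + G (2, 2) + G (3, 3) + G (4, 4))
     + 8 * (G (2, 1) + G (3, 1) + G (3, 2) + G (4, 1) + G (4, 2) + G (4, 3))"
proof -
  have "sum G (grid_box 4) = sum G (grid_box (Suc (Suc (Suc (Suc 0)))))" by (simp add: eval_nat_numeral)
  moreover have "grid_box 0 = {(0, 0)}" by (auto simp: grid_box_def)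
  ultimately show ?thesis
    unfolding sum_box_Suc by (simp add: numeral_eq_Suc atLeastAtMostSuc_conv)
qed

locale unit_form =
  fixes p u h :: real
  assumes p_ge: "1 \<le> p" and disc: "p\<^sup>2 = 1 + u\<^sup>2 + h\<^sup>2"
begin

text \<open>Cauchy-Schwarz against the unit vector (D/N, E/N), in the form of Lagrange's
  identity.\<close>

lemma weight_le:
  assumes "0 < N" "D\<^sup>2 + E\<^sup>2 = N\<^sup>2"
  shows "((u * D + h * E) / N)\<^sup>2 \<le> p\<^sup>2 - 1"
proof -
  have "0 \<le> (u * E - h * D)\<^sup>2" by simp
  also have "\<dots> = (u\<^sup>2 + h\<^sup>2) * (D\<^sup>2 + E\<^sup>2) - (u * D + h * E)\<^sup>2" by algebra
  finally have "(u * D + h * E)\<^sup>2 \<le> (p\<^sup>2 - 1) * N\<^sup>2" using assms disc by simp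
  then show ?thesis using assms by (simp add: power_divide pos_divide_le_eq)
qed

text \<open>The smaller eigenvalue p - sqrt (p^2 - 1) is the inverse of the larger one, hence at
  least 1 / (2 p). This yields convergence and, in \<open>reduction\<close>, finiteness.\<close>

lemma qform_ge: "(real_of_int m ^ 2 + real_of_int n ^ 2) / (2 * p) \<le> qform p u h (m, n)"
proof (cases "m = 0 \<and> n = 0")
  case False
  define N D E where "N = real_of_int m ^ 2 + real_of_int n ^ 2"
    and "D = real_of_int m ^ 2 - real_of_int n ^ 2" and "E = 2 * real_of_int m * real_of_int n"
  have N: "0 < N" unfolding N_def using False by (simp add: sum_power2_gt_zero_iff)
  have NDE: "D\<^sup>2 + E\<^sup>2 = N\<^sup>2" unfolding N_def D_def E_def by algebra
  define w where "w = (u * D + h * E) / N"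
  have w: "w\<^sup>2 \<le> p\<^sup>2 - 1" unfolding w_def by (rule weight_le[OF N NDE])
  have "(p + w) * (p - w) \<ge> 1" using w by (simp add: power2_eq_square algebra_simps)
  moreover have "p - w \<le> 2 * p" "0 < p + w" "0 < p - w" using recip_sum_pos[OF p_ge w] by auto
  then have "(p + w) * (p - w) \<le> (p + w) * (2 * p)" by (intro mult_left_mono) auto
  ultimately have "1 / (2 * p) \<le> p + w" using p_ge by (simp add: divide_le_eq)
  then have "N * (1 / (2 * p)) \<le> N * (p + w)" using N by (intro mult_left_mono) auto
  also have "\<dots> = qform p u h (m, n)"
  proof -
    have Nw: "N * w = u * D + h * E" unfolding w_def using N by simp
    show ?thesis unfolding distrib_left Nw by (simp add: qform_def N_def D_def E_def)
  qed
  finally show ?thesis by (simp add: N_def)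
qed (simp add: qform_def)

lemma recip_qform_summable:
  assumes "3 \<le> k"
  shows "(\<lambda>v. 1 / qform p u h v ^ k) summable_on UNIV"
proof -
  have le: "norm (1 / qform p u h v ^ k) \<le> norm ((2 * p) ^ k * inv_cube v)" for v
  proof (cases "v = (0, 0)")
    case False
    obtain m n where v: "v = (m, n)" by (cases v)
    define N where "N = real_of_int m ^ 2 + real_of_int n ^ 2"
    have "N = real_of_int (m\<^sup>2 + n\<^sup>2)" by (simp add: N_def)
    moreover have "1 \<le> m\<^sup>2 + n\<^sup>2" using False sum_power2_gt_zero_iff[of m n] v by simp
    ultimately have N: "1 \<le> N" by linarith
    have q: "N / (2 * p) \<le> qform p u h v" using qform_ge[of m n] by (simp add: v N_def)
    have qpos: "0 < qform p u h v" using N p_ge by (intro less_le_trans[OF _ q] divide_pos_pos) auto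
    have "1 / qform p u h v ^ k \<le> 1 / (N / (2 * p)) ^ k"
      using q N p_ge by (intro divide_left_mono power_mono mult_pos_pos zero_less_power qpos) auto
    also have "\<dots> = (2 * p) ^ k * (1 / N ^ k)" by (simp add: power_divide)
    also have "\<dots> \<le> (2 * p) ^ k * (1 / N ^ 3)"
      using N p_ge assms by (intro mult_left_mono divide_left_mono power_increasing) auto
    also have "\<dots> = (2 * p) ^ k * inv_cube v" by (simp add: inv_cube_def v N_def)
    finally show ?thesis using qpos p_ge inv_cube_nonneg[of v] by simp
  qed (use assms in \<open>auto simp: qform_def inv_cube_def power_0_left\<close>)
  have "(\<lambda>v. (2 * p) ^ k * inv_cube v) summable_on UNIV"
    by (intro summable_on_cmult_right inv_cube_summable)
  then have "(\<lambda>v. norm ((2 * p) ^ k * inv_cube v)) summable_on UNIV"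
    by (rule summable_on_iff_abs_summable_on_real[THEN iffD1])
  from Infinite_Sum.abs_summable_on_comparison_test[OF this le] show ?thesis
    by (rule summable_on_iff_abs_summable_on_real[THEN iffD2])
qed

lemma lj_qform_summable: "(\<lambda>v. lj b (qform p u h v)) summable_on UNIV"
  and infsum_lj_qform: "infsum (\<lambda>v. lj b (qform p u h v)) UNIV =
    infsum (\<lambda>v. 1 / qform p u h v ^ 6) UNIV - b * infsum (\<lambda>v. 1 / qform p u h v ^ 3) UNIV"
proof -
  have eq: "(\<lambda>v. lj b (qform p u h v)) = (\<lambda>v. 1 / qform p u h v ^ 6 + (- b) * (1 / qform p u h v ^ 3))"
    by (simp add: lj_def)
  have s: "(\<lambda>v. 1 / qform p u h v ^ 6) summable_on UNIV" "(\<lambda>v. 1 / qform p u h v ^ 3) summable_on UNIV"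
    by (simp_all add: recip_qform_summable)
  show "(\<lambda>v. lj b (qform p u h v)) summable_on UNIV"
    unfolding eq using s by (intro summable_on_add summable_on_cmult_right) auto
  show "infsum (\<lambda>v. lj b (qform p u h v)) UNIV =
    infsum (\<lambda>v. 1 / qform p u h v ^ 6) UNIV - b * infsum (\<lambda>v. 1 / qform p u h v ^ 3) UNIV"
    unfolding eq infsum_add[OF s(1) summable_on_cmult_right[OF s(2)]] infsum_cmult_right' by simp
qed

definition lj_diff :: "real \<Rightarrow> int \<times> int \<Rightarrow> real" where
  "lj_diff b v = lj b (qform p u h v) - lj b (qform 1 0 0 v)"

text \<open>The four images form two perpendicular pairs, with w = x + y and w = x - y. The factors
  of \<open>u\<close> and \<open>h\<close> are cosine and sine of twice the angle of (m, n).\<close>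

lemma symm_lj_diff_eq:
  assumes "(m, n) \<noteq> (0, 0)"
  defines "N \<equiv> real_of_int m ^ 2 + real_of_int n ^ 2"
  defines "x \<equiv> u * ((real_of_int m ^ 2 - real_of_int n ^ 2) / N)" and "y \<equiv> h * (2 * real_of_int m * real_of_int n / N)"
  shows "symm (lj_diff b) (m, n) =
    ((recip_sum 6 p (x + y) + recip_sum 6 p (x - y) - 4) / N ^ 6
      - b * (recip_sum 3 p (x + y) + recip_sum 3 p (x - y) - 4) / N ^ 3) / 4"
proof -
  have N: "N \<noteq> 0" unfolding N_def using assms(1) by (simp add: sum_power2_eq_zero_iff)
  have xN: "N * x = u * (real_of_int m ^ 2 - real_of_int n ^ 2)" and yN: "N * y = h * (2 * real_of_int m * real_of_int n)"
    unfolding x_def y_def using N by auto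
  have q: "qform p u h (m, n) = N * (p + (x + y))" "qform p u h (n, m) = N * (p - (x - y))"
    "qform p u h (m, - n) = N * (p + (x - y))" "qform p u h (n, - m) = N * (p - (x + y))"
    unfolding qform_def right_diff_distrib distrib_left xN yN by (simp_all add: N_def algebra_simps)
  have q1: "qform 1 0 0 (m, n) = N" "qform 1 0 0 (n, m) = N" "qform 1 0 0 (m, - n) = N" "qform 1 0 0 (n, - m) = N"
    by (simp_all add: qform_def N_def)
  have lj: "lj b (N * t) = (1 / t ^ 6) / N ^ 6 - b * (1 / t ^ 3) / N ^ 3" for t
    by (simp add: lj_def power_mult_distrib mult.commute)
  have lj1: "lj b N = 1 / N ^ 6 - b / N ^ 3" by (simp add: lj_def)
  show ?thesis
    unfolding symm_def lj_diff_def prod.case q q1 lj lj1 recip_sum_def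
    by (simp add: add_divide_distrib diff_divide_distrib distrib_left right_diff_distrib)
qed

lemma dihedral_symm: "dihedral (symm (lj_diff b))"
proof
  fix m n :: int
  have e: "lj_diff b (- m, - n) = lj_diff b (m, n)" "lj_diff b (- m, n) = lj_diff b (m, - n)" for m n
    by (simp_all add: lj_diff_def qform_def)
  show "symm (lj_diff b) (n, m) = symm (lj_diff b) (m, n)" by (simp add: symm_def)
  show "symm (lj_diff b) (- m, n) = symm (lj_diff b) (m, n)" by (simp add: symm_def e)
qed

text \<open>This is T_3(p) - 1, or cosh (3 a) - 1 for p = cosh a; by \<open>recip_sum_3_le\<close> a
  pair of inverse cubes exceeds 2 by at most 2 K.\<close>

definition K :: real where "K = 4 * p ^ 3 - 3 * p - 1"

lemma K_nonneg: "0 \<le> K"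
proof -
  have "0 \<le> (p - 1) * (2 * p + 1)\<^sup>2" using p_ge by simp
  also have "\<dots> = K" unfolding K_def by algebra
  finally show ?thesis .
qed

lemma pair_bounds:
  assumes "w\<^sup>2 \<le> p\<^sup>2 - 1" "w'\<^sup>2 \<le> p\<^sup>2 - 1"
  shows "- (8 / 3) * K \<le> recip_sum 6 p w + recip_sum 6 p w' - 4"
    and "recip_sum 3 p w + recip_sum 3 p w' - 4 \<le> 4 * K"
proof -
  show "- (8 / 3) * K \<le> recip_sum 6 p w + recip_sum 6 p w' - 4"
    using recip_sum_6_ge[OF p_ge assms(1)] recip_sum_6_ge[OF p_ge assms(2)] unfolding K_def by (simp add: field_simps)
  show "recip_sum 3 p w + recip_sum 3 p w' - 4 \<le> 4 * K"
    using recip_sum_3_le[OF p_ge assms(1)] recip_sum_3_le[OF p_ge assms(2)] unfolding K_def by simp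
qed

lemma symm_weights:
  fixes m n :: int
  assumes "(m, n) \<noteq> (0, 0)"
  defines "N \<equiv> real_of_int m ^ 2 + real_of_int n ^ 2"
  defines "x \<equiv> u * ((real_of_int m ^ 2 - real_of_int n ^ 2) / N)" and "y \<equiv> h * (2 * real_of_int m * real_of_int n / N)"
  shows "0 < N" "(x + y)\<^sup>2 \<le> p\<^sup>2 - 1" "(x - y)\<^sup>2 \<le> p\<^sup>2 - 1"
proof -
  show N: "0 < N" unfolding N_def using assms(1) by (simp add: sum_power2_gt_zero_iff)
  define D E where "D = real_of_int m ^ 2 - real_of_int n ^ 2" and "E = 2 * real_of_int m * real_of_int n"
  have "D\<^sup>2 + E\<^sup>2 = N\<^sup>2" "D\<^sup>2 + (- E)\<^sup>2 = N\<^sup>2"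
    unfolding N_def D_def E_def by algebra+
  from weight_le[OF N this(1)] weight_le[OF N this(2)]
  show "(x + y)\<^sup>2 \<le> p\<^sup>2 - 1" "(x - y)\<^sup>2 \<le> p\<^sup>2 - 1"
    unfolding x_def y_def D_def[symmetric] E_def[symmetric]
    by (simp_all add: add_divide_distrib diff_divide_distrib)
qed

text \<open>For N >= 16 the inverse sixth powers lose at most (8/3) / 4 / 16^3 = 1/6144 times K /
  N^3, which 1/6000 covers.\<close>

lemma symm_lj_diff_ge:
  fixes m n :: int
  assumes "0 \<le> b" and 16: "16 \<le> real_of_int m ^ 2 + real_of_int n ^ 2"
  shows "- ((b + 1 / 6000) * K) * inv_cube (m, n) \<le> symm (lj_diff b) (m, n)"
proof -
  define N where "N = real_of_int m ^ 2 + real_of_int n ^ 2"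
  define x y where "x = u * ((real_of_int m ^ 2 - real_of_int n ^ 2) / N)" and "y = h * (2 * real_of_int m * real_of_int n / N)"
  have mn: "(m, n) \<noteq> (0, 0)" using 16 by auto
  note w = symm_weights[OF mn, folded N_def, folded x_def y_def]
  note b = pair_bounds[OF w(2,3)]
  have N: "16 \<le> N" using 16 by (simp add: N_def)
  have "16 ^ 3 \<le> N ^ 3" using N by (intro power_mono) auto
  then have "1 / N ^ 3 \<le> 1 / 4096" using N by (intro divide_left_mono) auto
  then have "1 / N ^ 3 * (1 / N ^ 3) \<le> 1 / N ^ 3 * (1 / 4096)" using N by (intro mult_left_mono) auto
  moreover have "1 / N ^ 3 * (1 / N ^ 3) = 1 / N ^ 6" by (simp flip: power_add)
  ultimately have N6: "1 / N ^ 6 \<le> (1 / 4096) * (1 / N ^ 3)" by simp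
  define i3 i6 A C where "i3 = 1 / N ^ 3" and "i6 = 1 / N ^ 6"
    and "A = recip_sum 6 p (x + y) + recip_sum 6 p (x - y) - 4"
    and "C = recip_sum 3 p (x + y) + recip_sum 3 p (x - y) - 4"
  have "- (8 / 3) * K * i6 \<le> A * i6"
    using b(1) N unfolding A_def i6_def by (intro mult_right_mono) auto
  moreover have "(8 / 3) * K * i6 \<le> (8 / 3) * K * ((1 / 4096) * i3)"
    using N6 K_nonneg unfolding i6_def i3_def by (intro mult_left_mono) auto
  moreover have "b * C * i3 \<le> b * (4 * K) * i3"
    using b(2) assms N unfolding C_def i3_def by (intro mult_right_mono mult_left_mono) auto
  moreover have "0 \<le> K * i3" using K_nonneg N unfolding i3_def by simp
  ultimately have "- ((b + 1 / 6000) * K) * i3 \<le> (A * i6 - b * C * i3) / 4"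
    by (simp add: algebra_simps)
  then show ?thesis
    unfolding symm_lj_diff_eq[OF mn, folded N_def, folded x_def y_def, folded A_def C_def]
      inv_cube_def prod.case N_def[symmetric] i3_def i6_def by simp
qed

end

lemma pair_average:
  fixes x y A B b :: real
  shows "((x + x - 4) / A - b * (y + y - 4) / B) / 4 = ((x - 2) / A - b * (y - 2) / B) / 2"
  by (simp add: diff_divide_distrib add_divide_distrib right_diff_distrib distrib_left)

context unit_form
begin

section \<open>The orbits inside the box\<close>

lemma symm_axis:
  assumes "0 < k"
  shows "symm (lj_diff b) (k, 0) =
    ((recip_sum 6 p u - 2) / real_of_int k ^ 12 - b * (recip_sum 3 p u - 2) / real_of_int k ^ 6) / 2"
proof -
  have "symm (lj_diff b) (k, 0) =
    ((recip_sum 6 p u + recip_sum 6 p u - 4) / (real_of_int k ^ 2) ^ 6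
      - b * (recip_sum 3 p u + recip_sum 3 p u - 4) / (real_of_int k ^ 2) ^ 3) / 4"
    using symm_lj_diff_eq[of k 0 b] assms by simp
  then show ?thesis unfolding pair_average by (simp flip: power_mult)
qed

lemma symm_diagonal:
  assumes "0 < k"
  shows "symm (lj_diff b) (k, k) =
    ((recip_sum 6 p h - 2) / (64 * real_of_int k ^ 12) - b * (recip_sum 3 p h - 2) / (8 * real_of_int k ^ 6)) / 2"
proof -
  have e: "real_of_int k ^ 2 + real_of_int k ^ 2 = 2 * real_of_int k ^ 2"
    "2 * real_of_int k * real_of_int k / (2 * real_of_int k ^ 2) = 1"
    using assms by (simp_all add: power2_eq_square)
  have s: "recip_sum i p (- h) = recip_sum i p h" for i by (simp add: recip_sum_def)
  have "symm (lj_diff b) (k, k) =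
    ((recip_sum 6 p h + recip_sum 6 p h - 4) / (2 * real_of_int k ^ 2) ^ 6
      - b * (recip_sum 3 p h + recip_sum 3 p h - 4) / (2 * real_of_int k ^ 2) ^ 3) / 4"
    using symm_lj_diff_eq[of k k b, unfolded e] assms s by simp
  then show ?thesis unfolding pair_average power_mult_distrib by (simp flip: power_mult)
qed

lemma recip_sum_6_u_h: "- (4 / 3) * K \<le> recip_sum 6 p u - 2" "- (4 / 3) * K \<le> recip_sum 6 p h - 2"
proof -
  have "u\<^sup>2 \<le> p\<^sup>2 - 1" "h\<^sup>2 \<le> p\<^sup>2 - 1" using disc by auto
  from recip_sum_6_ge[OF p_ge this(1)] recip_sum_6_ge[OF p_ge this(2)]
  show "- (4 / 3) * K \<le> recip_sum 6 p u - 2" "- (4 / 3) * K \<le> recip_sum 6 p h - 2"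
    unfolding K_def by auto
qed

text \<open>Only the inverse sixth powers are estimated here; the inverse cubes stay exact, ready
  for the Taylor bounds. The equation for \<open>N\<close> amounts to N = m^2 + n^2.\<close>

lemma symm_rest:
  fixes m n :: int and N :: real
  assumes N: "0 < N" "N\<^sup>2 * real_of_int (m\<^sup>2 + n\<^sup>2) = N ^ 2 * N"
  assumes "(m, n) \<noteq> (0, 0)" and xy: "u * (real_of_int (m\<^sup>2 - n\<^sup>2) / N) = x" "h * (real_of_int (2 * m * n) / N) = y"
  shows "(- (8 / 3) * K / N ^ 6 - b * (recip_sum 3 p (x + y) + recip_sum 3 p (x - y) - 4) / N ^ 3) / 4
    \<le> symm (lj_diff b) (m, n)"
proof -
  have N': "real_of_int m ^ 2 + real_of_int n ^ 2 = N" using N by simp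
  have x: "u * ((real_of_int m ^ 2 - real_of_int n ^ 2) / N) = x" "h * (2 * real_of_int m * real_of_int n / N) = y"
    using xy by simp_all
  note eq = symm_lj_diff_eq[OF assms(3), of b, unfolded N' x]
  note w = symm_weights[OF assms(3), unfolded N' x]
  show ?thesis
    unfolding eq using pair_bounds(1)[OF w(2,3)] N
    by (intro divide_right_mono diff_mono order_refl) auto
qed

text \<open>Halving gives the orbits of (1,0) and (1,1) weight one. The coefficient 41/5000 of
  \<open>K\<close> in \<open>lower\<close> covers about 0.0044 from outside the box, 0.0033 from
  (4,1) and (4,3), and 0.0005 from inverse sixth powers.\<close>

lemma half_infsum_lj_diff_ge:
  assumes b: "(153/50) \<le> b" "b \<le> (1531/500)"
  shows "lower (b * (1 + 1 / 64 + 1 / 729 + 1 / 4096)) p u h \<le> infsum (lj_diff b) UNIV / 2"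
proof -
  interpret one: unit_form 1 0 0 by unfold_locales auto
  interpret G: dihedral "symm (lj_diff b)" by (rule dihedral_symm)
  let ?G = "symm (lj_diff b)"
  have summable: "lj_diff b summable_on UNIV"
    unfolding lj_diff_def[abs_def] diff_conv_add_uminus
    using lj_qform_summable[of b] one.lj_qform_summable[of b]
    by (intro summable_on_add) (auto simp: summable_on_uminus)
  note sG = infsum_symm[OF summable]
  have sG': "?G summable_on A" for A using sG(1) summable_on_subset_banach by blast
  define \<kappa> where "\<kappa> = (b + 1 / 6000) * K"
  have \<kappa>: "0 \<le> \<kappa>" "\<kappa> \<le> (15311/5000) * K"
    using b K_nonneg mult_right_mono[of "b + 1 / 6000" "15311 / 5000" K] unfolding \<kappa>_def by auto
  define Out where "Out = infsum ?G (- grid_box 4)"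
  have split: "infsum (lj_diff b) UNIV = sum ?G (grid_box 4) + Out"
  proof -
    have "infsum ?G (grid_box 4 \<union> - grid_box 4) = infsum ?G (grid_box 4) + infsum ?G (- grid_box 4)"
      by (rule infsum_Un_disjoint[OF sG' sG']) auto
    then show ?thesis using sG(2) by (simp add: Out_def)
  qed
  have Out: "- (71/25000) * \<kappa> \<le> Out"
  proof -
    have "- \<kappa> * inv_cube v \<le> ?G v" if "v \<in> - grid_box 4" for v
    proof -
      obtain m n where v: "v = (m, n)" by (cases v)
      have "4 \<le> \<bar>m\<bar> \<or> 4 \<le> \<bar>n\<bar>" using that unfolding v grid_box_def by auto
      then have "4\<^sup>2 \<le> m\<^sup>2 \<or> 4\<^sup>2 \<le> n\<^sup>2"
        using power_mono[of 4 "\<bar>m\<bar>" 2] power_mono[of 4 "\<bar>n\<bar>" 2] by auto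
      then have "16 \<le> m\<^sup>2 + n\<^sup>2" by (auto intro: add_increasing add_increasing2)
      then have "real_of_int 16 \<le> real_of_int (m\<^sup>2 + n\<^sup>2)" by (simp only: of_int_le_iff)
      then show ?thesis using symm_lj_diff_ge[of b m n] b unfolding v \<kappa>_def by simp
    qed
    then have "infsum (\<lambda>v. - \<kappa> * inv_cube v) (- grid_box 4) \<le> Out"
      unfolding Out_def
      by (intro infsum_mono summable_on_cmult_right inv_cube_summable_outside sG')
    moreover have "infsum (\<lambda>v. - \<kappa> * inv_cube v) (- grid_box 4) = - (\<kappa> * infsum inv_cube (- grid_box 4))"
      by (simp only: infsum_cmult_right')
    moreover have "\<kappa> * infsum inv_cube (- grid_box 4) \<le> \<kappa> * (71/25000)"
      using infsum_inv_cube_outside \<kappa> by (intro mult_left_mono) auto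
    ultimately show ?thesis by simp
  qed
  define x6 x3 y6 y3 where "x6 = recip_sum 6 p u - 2" and "x3 = b * (recip_sum 3 p u - 2)"
    and "y6 = recip_sum 6 p h - 2" and "y3 = b * (recip_sum 3 p h - 2)"
  note axis = symm_axis[of _ b, folded x6_def x3_def] and diag = symm_diagonal[of _ b, folded y6_def y3_def]
  have pos6: "- (4 / 3) * K \<le> x6" "- (4 / 3) * K \<le> y6" using recip_sum_6_u_h by (auto simp: x6_def y6_def)
  define s where "s = (\<lambda>x y. recip_sum 3 p (x + y) + recip_sum 3 p (x - y) - 4)"
  have G21: "(- (8 / 3) * K / 5 ^ 6 - b * s (3 * u / 5) (4 * h / 5) / 5 ^ 3) / 4 \<le> ?G (2, 1)"
    unfolding s_def by (rule symm_rest) auto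
  have G42: "(- (8 / 3) * K / 20 ^ 6 - b * s (3 * u / 5) (4 * h / 5) / 20 ^ 3) / 4 \<le> ?G (4, 2)"
    unfolding s_def by (rule symm_rest) auto
  have G31: "(- (8 / 3) * K / 10 ^ 6 - b * s (4 * u / 5) (3 * h / 5) / 10 ^ 3) / 4 \<le> ?G (3, 1)"
    unfolding s_def by (rule symm_rest) auto
  have G32: "(- (8 / 3) * K / 13 ^ 6 - b * s (5 * u / 13) (12 * h / 13) / 13 ^ 3) / 4 \<le> ?G (3, 2)"
    unfolding s_def by (rule symm_rest) auto
  have G41: "- \<kappa> / 17 ^ 3 \<le> ?G (4, 1)" and G43: "- \<kappa> / 25 ^ 3 \<le> ?G (4, 3)"
    using symm_lj_diff_ge[of b 4 1] symm_lj_diff_ge[of b 4 3] b by (simp_all add: \<kappa>_def inv_cube_def)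
  have G00: "?G (0, 0) = 0" by (simp add: symm_def lj_diff_def qform_def)
  define R where "R = rest_bound (1 / p) (u\<^sup>2) (h\<^sup>2)"
  define s1 s2 s3 where "s1 = b * s (3 * u / 5) (4 * h / 5)" and "s2 = b * s (4 * u / 5) (3 * h / 5)"
    and "s3 = b * s (5 * u / 13) (12 * h / 13)"
  have R: "65 / 8000 * s1 + s2 / 1000 + s3 / 2197 \<le> (1531/500) * R"
  proof -
    define j where "j = 1 / p"
    have j: "0 \<le> j" "j \<le> 1" using p_ge by (auto simp: j_def)
    have w: "((3 * u + 4 * h) / 5)\<^sup>2 \<le> p\<^sup>2 - 1" "((3 * u - 4 * h) / 5)\<^sup>2 \<le> p\<^sup>2 - 1"
      "((4 * u + 3 * h) / 5)\<^sup>2 \<le> p\<^sup>2 - 1" "((4 * u - 3 * h) / 5)\<^sup>2 \<le> p\<^sup>2 - 1"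
      "((5 * u + 12 * h) / 13)\<^sup>2 \<le> p\<^sup>2 - 1" "((5 * u - 12 * h) / 13)\<^sup>2 \<le> p\<^sup>2 - 1"
      using weight_le[of 5 3 4] weight_le[of 5 3 "-4"] weight_le[of 5 4 3] weight_le[of 5 4 "-3"]
        weight_le[of 13 5 12] weight_le[of 13 5 "-12"] by (simp_all add: mult.commute)
    have s_eq: "s (3 * u / 5) (4 * h / 5) = recip_sum 3 p ((3 * u + 4 * h) / 5) + recip_sum 3 p ((3 * u - 4 * h) / 5) - 4"
      "s (4 * u / 5) (3 * h / 5) = recip_sum 3 p ((4 * u + 3 * h) / 5) + recip_sum 3 p ((4 * u - 3 * h) / 5) - 4"
      "s (5 * u / 13) (12 * h / 13) = recip_sum 3 p ((5 * u + 12 * h) / 13) + recip_sum 3 p ((5 * u - 12 * h) / 13) - 4"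
      by (simp_all add: s_def add_divide_distrib diff_divide_distrib)
    have "65 / 8000 * s (3 * u / 5) (4 * h / 5) + 1 / 1000 * s (4 * u / 5) (3 * h / 5)
        + 1 / 2197 * s (5 * u / 13) (12 * h / 13) \<le> R"
    proof -
      have o2: "recip_sum 3 p x + recip_sum 3 p y - 4 \<le> (4 * j ^ 3 - 4) + 12 * j ^ 5 * (x\<^sup>2 + y\<^sup>2)
          + (8 * j + 10 * j ^ 3 + 12 * j ^ 5) * (x ^ 4 + y ^ 4)"
        if "x\<^sup>2 \<le> p\<^sup>2 - 1" "y\<^sup>2 \<le> p\<^sup>2 - 1" for x y
        using recip_sum_3_le_order2[OF p_ge that(1), folded j_def] recip_sum_3_le_order2[OF p_ge that(2), folded j_def]
        by (simp add: algebra_simps)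
      have o3: "recip_sum 3 p x + recip_sum 3 p y - 4 \<le> (4 * j ^ 3 - 4) + 12 * j ^ 5 * (x\<^sup>2 + y\<^sup>2)
          + 30 * j ^ 7 * (x ^ 4 + y ^ 4) + (8 * j ^ 3 + 18 * j ^ 5 + 30 * j ^ 7) * (x ^ 6 + y ^ 6)"
        if "x\<^sup>2 \<le> p\<^sup>2 - 1" "y\<^sup>2 \<le> p\<^sup>2 - 1" for x y
        using recip_sum_3_le_order3[OF p_ge that(1), folded j_def] recip_sum_3_le_order3[OF p_ge that(2), folded j_def]
        by (simp add: algebra_simps)
      show ?thesis
        unfolding R_def s_eq j_def[symmetric]
        by (rule order_trans[OF _ rest_bound_weighted[OF j, of u h]])
           (intro add_mono mult_left_mono o2 o3 w; simp)
    qed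
    then have "b * (65 / 8000 * s (3 * u / 5) (4 * h / 5) + 1 / 1000 * s (4 * u / 5) (3 * h / 5)
        + 1 / 2197 * s (5 * u / 13) (12 * h / 13)) \<le> b * R"
      using b by (intro mult_left_mono) auto
    also have "\<dots> \<le> (1531/500) * R"
      using b rest_bound_nonneg[of p "u\<^sup>2" "h\<^sup>2"] p_ge disc unfolding R_def by (intro mult_right_mono) auto
    finally show ?thesis unfolding s1_def s2_def s3_def by (simp add: algebra_simps)
  qed
  have lower: "lower (b * (1 + 1 / 64 + 1 / 729 + 1 / 4096)) p u h
     = x6 + y6 / 64 - (1 + 1 / 64 + 1 / 729 + 1 / 4096) * (x3 + y3 / 8) - (1531/500) * R - (41/5000) * K"
  proof -
    have e: "2 * p + 2 * h = 2 * (p + h)" "2 * p - 2 * h = 2 * (p - h)" by simp_all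
    define a6 a3 c6 c3 where "a6 = 1 / (p + u) ^ 6 + 1 / (p - u) ^ 6" and "a3 = 1 / (p + u) ^ 3 + 1 / (p - u) ^ 3"
      and "c6 = 1 / (p + h) ^ 6 + 1 / (p - h) ^ 6" and "c3 = 1 / (p + h) ^ 3 + 1 / (p - h) ^ 3"
    have c: "1 / (2 * (p + h)) ^ 6 + 1 / (2 * (p - h)) ^ 6 = c6 / 64"
      "1 / (2 * (p + h)) ^ 3 + 1 / (2 * (p - h)) ^ 3 = c3 / 8"
      unfolding power_mult_distrib by (simp_all add: c6_def c3_def add_divide_distrib)
    show ?thesis
      unfolding lower_def main_part_def e c x6_def x3_def y6_def y3_def R_def[symmetric] K_def[symmetric] recip_sum_def
        a6_def[symmetric] a3_def[symmetric] c6_def[symmetric] c3_def[symmetric]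
      by algebra
  qed
  have axis': "?G (1, 0) = (x6 - x3) / 2" "?G (2, 0) = (x6 / 4096 - x3 / 64) / 2"
    "?G (3, 0) = (x6 / 531441 - x3 / 729) / 2" "?G (4, 0) = (x6 / 16777216 - x3 / 4096) / 2"
    using axis[of 1] axis[of 2] axis[of 3] axis[of 4] by simp_all
  have diag': "?G (1, 1) = (y6 / 64 - y3 / 8) / 2" "?G (2, 2) = (y6 / 64 / 4096 - y3 / 8 / 64) / 2"
    "?G (3, 3) = (y6 / 64 / 531441 - y3 / 8 / 729) / 2" "?G (4, 4) = (y6 / 64 / 16777216 - y3 / 8 / 4096) / 2"
    using diag[of 1] diag[of 2] diag[of 3] diag[of 4] by simp_all
  show ?thesis
    unfolding lower split G.sum_grid_box_4 G00 axis' diag'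
    using G21 G42 G31 G32 G41 G43 Out \<kappa> R pos6 K_nonneg
    unfolding s1_def[symmetric] s2_def[symmetric] s3_def[symmetric]
    by (simp add: field_simps)
qed

end

section \<open>Reduction and the lattice zeta function\<close>

text \<open>Swapping the coordinates reverses the sign of u, negating one of them that of h.\<close>

lemma infsum_qform_abs:
  "infsum (\<lambda>v. F (qform p \<bar>u\<bar> \<bar>h\<bar> v)) UNIV = infsum (\<lambda>v. F (qform p u h v)) UNIV"
proof -
  have swap: "infsum (\<lambda>v. F (qform p (- u) h v)) UNIV = infsum (\<lambda>v. F (qform p u h v)) UNIV" for u h
  proof -
    have "qform p (- u) h v = qform p u h ((\<lambda>(m, n). (n, m)) v)" for v
      by (cases v) (simp add: qform_def algebra_simps)
    then show ?thesis
      using infsum_reindex_bij_betw[OF bij_swap_flip(1), of "\<lambda>v. F (qform p u h v)"] by simp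
  qed
  have flip: "infsum (\<lambda>v. F (qform p u (- h) v)) UNIV = infsum (\<lambda>v. F (qform p u h v)) UNIV" for u h
  proof -
    have "qform p u (- h) v = qform p u h ((\<lambda>(m, n). (m, - n)) v)" for v
      by (cases v) (simp add: qform_def)
    then show ?thesis
      using infsum_reindex_bij_betw[OF bij_swap_flip(2), of "\<lambda>v. F (qform p u h v)"] by simp
  qed
  show ?thesis by (cases "0 \<le> u"; cases "0 \<le> h") (simp_all add: swap flip)
qed

text \<open>Here \<open>B\<close> is the value of the polar form on the new basis vectors.\<close>

lemma infsum_qform_basis:
  fixes a b c d :: int and p u h :: real
  assumes det: "(a * d - b * c)\<^sup>2 = 1"
  defines "B \<equiv> (qform p u h (a + c, b + d) - qform p u h (a, b) - qform p u h (c, d)) / 2"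
  defines "P \<equiv> (qform p u h (a, b) + qform p u h (c, d)) / 2"
    and "V \<equiv> (qform p u h (a, b) - qform p u h (c, d)) / 2"
  shows "infsum (\<lambda>v. F (qform p u h v)) UNIV = infsum (\<lambda>v. F (qform P V B v)) UNIV"
    and "P\<^sup>2 - V\<^sup>2 - B\<^sup>2 = p\<^sup>2 - u\<^sup>2 - h\<^sup>2"
proof -
  define e where "e = a * d - b * c"
  have e: "e * e = 1" using det by (simp add: e_def power2_eq_square)
  let ?f = "\<lambda>(m, n). (m * a + n * c, m * b + n * d)"
  let ?g = "\<lambda>(m, n). (e * (d * m - c * n), e * (a * n - b * m))"
  have "bij ?f"
  proof (rule o_bij[of ?g])
    have 1: "e * (d * (m * a + n * c) - c * (m * b + n * d)) = m" "e * (a * (m * b + n * d) - b * (m * a + n * c)) = n" for m n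
    proof -
      have "e * (d * (m * a + n * c) - c * (m * b + n * d)) = (e * e) * m"
        "e * (a * (m * b + n * d) - b * (m * a + n * c)) = (e * e) * n" by (simp_all add: e_def algebra_simps)
      then show "e * (d * (m * a + n * c) - c * (m * b + n * d)) = m" "e * (a * (m * b + n * d) - b * (m * a + n * c)) = n"
        unfolding e by simp_all
    qed
    have 2: "e * (d * m - c * n) * a + e * (a * n - b * m) * c = m" "e * (d * m - c * n) * b + e * (a * n - b * m) * d = n" for m n
    proof -
      have "e * (d * m - c * n) * a + e * (a * n - b * m) * c = (e * e) * m"
        "e * (d * m - c * n) * b + e * (a * n - b * m) * d = (e * e) * n" by (simp_all add: e_def algebra_simps)
      then show "e * (d * m - c * n) * a + e * (a * n - b * m) * c = m" "e * (d * m - c * n) * b + e * (a * n - b * m) * d = n"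
        unfolding e by simp_all
    qed
    show "?g \<circ> ?f = id" using 1 by (auto simp: fun_eq_iff)
    show "?f \<circ> ?g = id" using 2 by (auto simp: fun_eq_iff)
  qed
  moreover have "qform p u h (?f v) = qform P V B v" for v
    by (cases v) (simp add: qform_def P_def V_def B_def power2_eq_square field_simps)
  ultimately show "infsum (\<lambda>v. F (qform p u h v)) UNIV = infsum (\<lambda>v. F (qform P V B v)) UNIV"
    using infsum_reindex_bij_betw[of ?f UNIV UNIV "\<lambda>v. F (qform p u h v)"] by simp
  have "real_of_int ((a * d - b * c)\<^sup>2) = 1" using det by simp
  then have "(real_of_int a * real_of_int d - real_of_int b * real_of_int c)\<^sup>2 = 1" by simp
  moreover have "P\<^sup>2 - V\<^sup>2 - B\<^sup>2
      = (p\<^sup>2 - u\<^sup>2 - h\<^sup>2) * (real_of_int a * real_of_int d - real_of_int b * real_of_int c)\<^sup>2"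
  proof -
    have B: "B = p * (real_of_int a * real_of_int c + real_of_int b * real_of_int d)
        + u * (real_of_int a * real_of_int c - real_of_int b * real_of_int d)
        + h * (real_of_int a * real_of_int d + real_of_int b * real_of_int c)"
      by (simp add: B_def qform_def power2_eq_square field_simps)
    have "P\<^sup>2 - V\<^sup>2 = qform p u h (a, b) * qform p u h (c, d)"
      by (simp add: P_def V_def power2_eq_square field_simps)
    then show ?thesis unfolding B qform_def prod.case by algebra
  qed
  ultimately show "P\<^sup>2 - V\<^sup>2 - B\<^sup>2 = p\<^sup>2 - u\<^sup>2 - h\<^sup>2" by simp
qed

text \<open>A basis minimising the sum of the two values of the form is reduced: replacing one basis vector
  by its sum or difference with the other cannot decrease the sum.\<close>

lemma (in unit_form) reduction:
  obtains P V B where "unit_form P V B" "0 \<le> V" "0 \<le> B" "2 * B \<le> P - V"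
    "\<forall>F :: real \<Rightarrow> real. infsum (\<lambda>v. F (qform p u h v)) UNIV = infsum (\<lambda>v. F (qform P V B v)) UNIV"
proof -
  let ?Q = "qform p u h"
  define cost where "cost = (\<lambda>(a, b, c, d). ?Q (a, b) + ?Q (c, d))"
  define S where "S = {(a, b, c, d). (a * d - b * c)\<^sup>2 = (1 :: int)}"
  \<comment> \<open>Only bases not worse than the standard one compete, and \<open>qform_ge\<close>
    leaves finitely many of them.\<close>
  define T where "T = {x \<in> S. cost x \<le> cost (1, 0, 0, 1)}"
  define M where "M = \<lfloor>2 * p * cost (1, 0, 0, 1)\<rfloor>"
  have "T \<subseteq> {- M..M} \<times> {- M..M} \<times> {- M..M} \<times> {- M..M}"
  proof
    fix x assume x: "x \<in> T"
    obtain a b c d where abcd: "x = (a, b, c, d)" by (cases x)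
    have "(real_of_int a ^ 2 + real_of_int b ^ 2) / (2 * p) + (real_of_int c ^ 2 + real_of_int d ^ 2) / (2 * p)
        \<le> cost (1, 0, 0, 1)"
      using x qform_ge[of a b] qform_ge[of c d] unfolding T_def abcd cost_def by simp
    then have "real_of_int a ^ 2 + real_of_int b ^ 2 + real_of_int c ^ 2 + real_of_int d ^ 2 \<le> 2 * p * cost (1, 0, 0, 1)"
      using p_ge unfolding add_divide_distrib[symmetric] by (simp add: pos_divide_le_eq mult.commute)
    then have "real_of_int (a\<^sup>2 + b\<^sup>2 + c\<^sup>2 + d\<^sup>2) \<le> 2 * p * cost (1, 0, 0, 1)" by simp
    then have le: "a\<^sup>2 + b\<^sup>2 + c\<^sup>2 + d\<^sup>2 \<le> M" unfolding M_def by (simp add: le_floor_iff)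
    have sq: "\<bar>k\<bar> \<le> k\<^sup>2" for k :: int
    proof (cases "k = 0")
      case False
      then have "\<bar>k\<bar> * 1 \<le> \<bar>k\<bar> * \<bar>k\<bar>" by (intro mult_left_mono) auto
      then show ?thesis by (simp add: power2_eq_square)
    qed simp
    have "\<bar>a\<bar> \<le> M" "\<bar>b\<bar> \<le> M" "\<bar>c\<bar> \<le> M" "\<bar>d\<bar> \<le> M"
      using le sq[of a] sq[of b] sq[of c] sq[of d] zero_le_power2[of a] zero_le_power2[of b]
        zero_le_power2[of c] zero_le_power2[of d] by linarith+
    then show "x \<in> {- M..M} \<times> {- M..M} \<times> {- M..M} \<times> {- M..M}" unfolding abcd by auto
  qed
  then have "finite T" by (rule finite_subset) simp
  moreover have "(1, 0, 0, 1) \<in> T" by (simp add: T_def S_def)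
  ultimately obtain x where x: "x \<in> T" "\<And>y. y \<in> T \<Longrightarrow> cost x \<le> cost y"
    using ex_is_arg_min_if_finite[of T cost] unfolding is_arg_min_linorder by blast
  have min: "cost x \<le> cost y" if "y \<in> S" for y
    using x that by (cases "cost y \<le> cost (1, 0, 0, 1)") (auto simp: T_def)
  obtain a b c d where abcd: "x = (a, b, c, d)" by (cases x)
  have det: "(a * d - b * c)\<^sup>2 = 1" using x(1) unfolding T_def S_def abcd by auto
  define B P V where "B = (?Q (a + c, b + d) - ?Q (a, b) - ?Q (c, d)) / 2"
    and "P = (?Q (a, b) + ?Q (c, d)) / 2" and "V = (?Q (a, b) - ?Q (c, d)) / 2"
  have Qadd: "?Q (a + c, b + d) = ?Q (a, b) + ?Q (c, d) + 2 * B"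
    and Qsub: "?Q (a - c, b - d) = ?Q (a, b) + ?Q (c, d) - 2 * B"
  proof -
    show "?Q (a + c, b + d) = ?Q (a, b) + ?Q (c, d) + 2 * B" by (simp add: B_def field_simps)
    moreover have "?Q (a + c, b + d) + ?Q (a - c, b - d) = 2 * ?Q (a, b) + 2 * ?Q (c, d)"
      by (simp add: qform_def power2_eq_square algebra_simps)
    ultimately show "?Q (a - c, b - d) = ?Q (a, b) + ?Q (c, d) - 2 * B" by simp
  qed
  have dets: "(a * (b + d) - b * (a + c))\<^sup>2 = 1" "(a * (b - d) - b * (a - c))\<^sup>2 = 1"
    "((a + c) * d - (b + d) * c)\<^sup>2 = 1" "((a - c) * d - (b - d) * c)\<^sup>2 = 1"
    using det by (simp_all add: algebra_simps power2_eq_square)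
  have "cost x \<le> cost (a, b, a + c, b + d)" "cost x \<le> cost (a, b, a - c, b - d)"
    "cost x \<le> cost (a + c, b + d, c, d)" "cost x \<le> cost (a - c, b - d, c, d)"
    using dets by (auto intro!: min simp: S_def)
  then have "2 * \<bar>B\<bar> \<le> ?Q (a, b)" "2 * \<bar>B\<bar> \<le> ?Q (c, d)"
    unfolding abcd cost_def prod.case Qadd Qsub by linarith+
  then have red: "2 * \<bar>B\<bar> \<le> P - \<bar>V\<bar>" unfolding P_def V_def by (auto simp: abs_if field_simps)
  note basis = infsum_qform_basis[OF det, where p = p and u = u and h = h, folded B_def P_def V_def]
  have PVB: "P\<^sup>2 = 1 + V\<^sup>2 + B\<^sup>2" using basis(2) disc by simp
  have "0 \<le> P" using red by linarith
  moreover have "1\<^sup>2 \<le> P\<^sup>2" unfolding PVB by simp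
  ultimately have "1 \<le> P" by (rule power2_le_imp_le[rotated])
  then have "unit_form P \<bar>V\<bar> \<bar>B\<bar>" using PVB by unfold_locales auto
  moreover have "\<forall>F :: real \<Rightarrow> real. infsum (\<lambda>v. F (qform p u h v)) UNIV = infsum (\<lambda>v. F (qform P \<bar>V\<bar> \<bar>B\<bar> v)) UNIV"
    unfolding infsum_qform_abs by (intro allI basis(1))
  ultimately show thesis using red by (intro that[of P "\<bar>V\<bar>" "\<bar>B\<bar>"]) auto
qed

lemma (in unit_form) infsum_lj_ge:
  assumes "(153/50) \<le> b" "b \<le> (1531/500)"
  shows "infsum (\<lambda>v. lj b (qform 1 0 0 v)) UNIV \<le> infsum (\<lambda>v. lj b (qform p u h v)) UNIV"
proof -
  obtain P V B where red: "unit_form P V B" "0 \<le> V" "0 \<le> B" "2 * B \<le> P - V"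
    "\<forall>F :: real \<Rightarrow> real. infsum (\<lambda>v. F (qform p u h v)) UNIV = infsum (\<lambda>v. F (qform P V B v)) UNIV"
    using reduction by blast
  interpret r: unit_form P V B by (rule red)
  interpret one: unit_form 1 0 0 by unfold_locales auto
  define P0 where "P0 = sqrt (1 + B\<^sup>2)"
  define \<beta> where "\<beta> = b * (1 + 1 / 64 + 1 / 729 + 1 / 4096)"
  have "reduced_point \<beta> P V B P0"
  proof
    show "(31127/10000) \<le> \<beta>" "\<beta> \<le> (623/200)" using assms by (simp_all add: \<beta>_def)
    show "1 \<le> P0" "P0\<^sup>2 = 1 + B\<^sup>2" by (simp_all add: P0_def)
    then show "P\<^sup>2 = P0\<^sup>2 + V\<^sup>2" using r.disc by simp
    then have "P0\<^sup>2 \<le> P\<^sup>2" by simp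
    then show "P0 \<le> P" by (rule power2_le_imp_le) (use r.p_ge in simp)
  qed (use red in auto)
  then have "0 \<le> lower \<beta> P V B" by (rule reduced_point.lower_nonneg)
  also have "\<dots> \<le> infsum (r.lj_diff b) UNIV / 2"
    unfolding \<beta>_def by (rule r.half_infsum_lj_diff_ge[OF assms])
  also have "infsum (r.lj_diff b) UNIV
      = infsum (\<lambda>v. lj b (qform P V B v)) UNIV - infsum (\<lambda>v. lj b (qform 1 0 0 v)) UNIV"
  proof -
    have eq: "r.lj_diff b = (\<lambda>v. lj b (qform P V B v) + - lj b (qform 1 0 0 v))"
      by (simp add: fun_eq_iff r.lj_diff_def)
    have "(\<lambda>v. - lj b (qform 1 0 0 v)) summable_on UNIV"
      using one.lj_qform_summable[of b] by (simp only: summable_on_uminus)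
    from infsum_add[OF r.lj_qform_summable this] show ?thesis unfolding eq infsum_uminus by simp
  qed
  finally show ?thesis using red(5) by simp
qed

section \<open>The zeta function as a sum over a form\<close>

lemma lattice_zeta_eq:
  assumes z: "0 < Im z" and k: "0 < k"
  defines "p \<equiv> (1 + (cmod z)\<^sup>2) / (2 * Im z)" and "u \<equiv> ((cmod z)\<^sup>2 - 1) / (2 * Im z)" and "h \<equiv> Re z / Im z"
  shows "lattice_zeta (real k) z = infsum (\<lambda>v. 1 / qform p u h v ^ k) UNIV"
    and "unit_form p u h"
proof -
  show uf: "unit_form p u h"
  proof
    have "0 \<le> (Re z)\<^sup>2 + (Im z - 1)\<^sup>2" by simp
    then have "2 * Im z \<le> 1 + (cmod z)\<^sup>2" unfolding cmod_power2 by (simp add: power2_eq_square algebra_simps)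
    then show "1 \<le> p" unfolding p_def using z by simp
    show "p\<^sup>2 = 1 + u\<^sup>2 + h\<^sup>2"
      unfolding p_def u_def h_def cmod_power2 using z by (simp add: field_simps power2_eq_square)
  qed
  have q: "Im z * qform p u h (m, n) = (cmod (of_int m * z + of_int n))\<^sup>2" for m n
  proof -
    have "Im z * qform p u h (m, n) = real_of_int m ^ 2 * (cmod z)\<^sup>2 + real_of_int n ^ 2 + 2 * Re z * (real_of_int m * real_of_int n)"
      unfolding p_def u_def h_def qform_def using z by (simp add: field_simps)
    also have "\<dots> = (cmod (of_int m * z + of_int n))\<^sup>2"
      unfolding cmod_power2 by (simp add: power2_eq_square algebra_simps)
    finally show ?thesis .
  qed
  show "lattice_zeta (real k) z = infsum (\<lambda>v. 1 / qform p u h v ^ k) UNIV"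
    unfolding lattice_zeta_def
  proof (rule infsum_cong_neutral)
    fix v assume "v \<in> UNIV - (UNIV - {(0 :: int, 0 :: int)})"
    \<comment> \<open>The origin, absent from the zeta sum, contributes only
      \<open>1 / 0 = 0\<close>.\<close>
    then show "1 / qform p u h v ^ k = 0" using k by (simp add: qform_def)
  next
    fix v :: "int \<times> int" assume v: "v \<in> (UNIV - {(0, 0)}) \<inter> UNIV"
    obtain m n where mn: "v = (m, n)" by (cases v)
    define r where "r = cmod (of_int m * z + of_int n)"
    have "r \<noteq> 0"
    proof
      assume "r = 0"
      then have "of_int m * z + of_int n = 0" by (simp add: r_def)
      then have "Im (of_int m * z + of_int n) = 0" "Re (of_int m * z + of_int n) = 0" by simp_all
      then show False using z v mn by auto
    qed
    then have r: "0 < r" by (simp add: r_def)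
    have "r powr (2 * real k) = (r\<^sup>2) ^ k"
      using r powr_realpow[of r "2 * k"] by (simp add: power_mult)
    also have "\<dots> = Im z ^ k * qform p u h (m, n) ^ k" by (simp add: r_def flip: q power_mult_distrib)
    finally have "Im z powr real k / r powr (2 * real k) = 1 / qform p u h (m, n) ^ k"
      using z by (simp add: powr_realpow)
    then show "(case v of (m, n) \<Rightarrow> Im z powr real k / cmod (of_int m * z + of_int n) powr (2 * real k))
        = 1 / qform p u h v ^ k"
      by (simp add: mn r_def)
  qed auto
qed

section \<open>The closure of the fundamental domain\<close>

lemma i_in_closure_D_G: "\<i> \<in> closure D_G"
proof (rule closure_approachable[THEN iffD2], intro allI impI)
  fix e :: real assume e: "0 < e"
  define t where "t = min (e / 4) (1 / 4)"
  have t: "0 < t" "t \<le> e / 4" "t \<le> 1 / 4" using e by (auto simp: t_def)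
  define w where "w = Complex t (1 + t)"
  have "1\<^sup>2 < (cmod w)\<^sup>2" using t unfolding cmod_power2 w_def by (simp add: power2_eq_square algebra_simps add_pos_pos)
  then have "1 < cmod w" by (rule power2_less_imp_less) simp
  then have "w \<in> D_G" using t by (auto simp: D_G_def w_def)
  moreover have "dist w \<i> < e"
  proof -
    have "dist w \<i> \<le> \<bar>Re (w - \<i>)\<bar> + \<bar>Im (w - \<i>)\<bar>" unfolding dist_norm by (rule cmod_le)
    also have "\<dots> < e" using t by (simp add: w_def)
    finally show ?thesis .
  qed
  ultimately show "\<exists>y\<in>D_G. dist y \<i> < e" by blast
qed

text \<open>Im z > 0 is not a closed condition, so a closed superset with Im z >= 0 is used. It
  misses the real axis, where |z| = |Re z| <= 1/2 contradicts |z| >= 1.\<close>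

lemma closure_D_G_subset: "closure D_G \<subseteq> upper_half_plane"
proof -
  have "closed {z. 1 \<le> cmod z \<and> \<bar>Re z\<bar> \<le> 1 / 2 \<and> 0 \<le> Im z}"
    by (intro closed_Collect_conj closed_Collect_le continuous_intros)
  then have "closure D_G \<subseteq> {z. 1 \<le> cmod z \<and> \<bar>Re z\<bar> \<le> 1 / 2 \<and> 0 \<le> Im z}"
    by (intro closure_minimal) (auto simp: D_G_def)
  also have "\<dots> \<subseteq> upper_half_plane"
  proof
    fix z assume z: "z \<in> {z. 1 \<le> cmod z \<and> \<bar>Re z\<bar> \<le> 1 / 2 \<and> 0 \<le> Im z}"
    have "Im z \<noteq> 0"
    proof
      assume "Im z = 0"
      then have "cmod z = \<bar>Re z\<bar>" by (simp add: cmod_def)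
      then show False using z by auto
    qed
    then show "z \<in> upper_half_plane" using z by (auto simp: upper_half_plane_def)
  qed
  finally show ?thesis .
qed

theorem theorem5p2:
  fixes b :: real
  assumes "3.06 < b" and "b < 3.062"
  defines "f \<equiv> (\<lambda>z. lattice_zeta 6 z - b * lattice_zeta 3 z)"
  shows "\<i> \<in> upper_half_plane \<and> \<i> \<in> closure D_G
         \<and> (\<forall>z\<in>upper_half_plane. f \<i> \<le> f z)
         \<and> (\<forall>z\<in>closure D_G. f \<i> \<le> f z)
         \<and> (INF z\<in>upper_half_plane. f z) = f \<i>
         \<and> (INF z\<in>closure D_G. f z) = f \<i>"
proof -
  have H: "\<i> \<in> upper_half_plane" by (simp add: upper_half_plane_def)
  interpret one: unit_form 1 0 0 by unfold_locales auto
  have f_i: "f \<i> = infsum (\<lambda>v. lj b (qform 1 0 0 v)) UNIV"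
    using lattice_zeta_eq(1)[of \<i> 6] lattice_zeta_eq(1)[of \<i> 3]
    unfolding f_def one.infsum_lj_qform by simp
  have min: "f \<i> \<le> f z" if z: "z \<in> upper_half_plane" for z
  proof -
    define p u h where "p = (1 + (cmod z)\<^sup>2) / (2 * Im z)" and "u = ((cmod z)\<^sup>2 - 1) / (2 * Im z)"
      and "h = Re z / Im z"
    have Im: "0 < Im z" using z by (simp add: upper_half_plane_def)
    interpret unit_form p u h unfolding p_def u_def h_def by (rule lattice_zeta_eq(2)[OF Im, of 1]) simp
    have "f z = infsum (\<lambda>v. lj b (qform p u h v)) UNIV"
      using lattice_zeta_eq(1)[OF Im, of 6, folded p_def u_def h_def]
        lattice_zeta_eq(1)[OF Im, of 3, folded p_def u_def h_def]
      unfolding f_def infsum_lj_qform by simp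
    then show ?thesis unfolding f_i using infsum_lj_ge[of b] assms by simp
  qed
  have INF: "(INF z\<in>A. f z) = f \<i>" if "A \<subseteq> upper_half_plane" "\<i> \<in> A" for A
    using that min by (intro cInf_eq_minimum) auto
  show ?thesis
    using H i_in_closure_D_G min closure_D_G_subset INF[OF order_refl H] INF[OF closure_D_G_subset i_in_closure_D_G]
    by blast
qed

end
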